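(* Let $\mathcal M$ be a regular statistical manifold endowed with the Fisher--Rao metric $g_\phi(u,v)=u^\top F_\phi v$, let $\mathcal J:\mathcal M\to\mathbb R$ be smooth, and fix $\phi\in\mathcal M$. Let $\mathcal R_\phi$ be any retraction on $\mathcal M$ satisfying $\mathcal R_\phi(0)=\phi$ and $\mathrm D\mathcal R_\phi(0)=\mathrm{Id}$ (the Riemannian exponential map $\mathrm{Exp}_\phi$ being a canonical retraction). Then, in local coordinates, as $\eta\to 0$, $$\mathrm{Exp}_\phi\big(-\eta\,F_\phi^{-1}\nabla_\phi\mathcal J\big)=\phi-\eta\,F_\phi^{-1}\nabla_\phi\mathcal J+O(\eta^2).$$ Hence, since $\mathrm{grad}\,\mathcal J=F_\phi^{-1}\nabla_\phi\mathcal J$, the additive natural-gradient step $\phi^{+}=\phi-\eta F_\phi^{-1}\nabla_\phi\mathcal J$ is a first-order approximation (i.e. agrees up to $O(\eta^2)$) to the geodesic update $\mathrm{Exp}_\phi(-\eta\,\mathrm{grad}\,\mathcal J(\phi))$.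
   Context: $p(x)$ is a fixed data distribution and $\{q_\phi(z\mid x)\}_\phi$ is a parametric family of conditional densities (encoders), $\phi\in\Theta$ with $\Theta\subset\mathbb R^d$ open; $\mathcal M$ is this family with $\phi$ as coordinates, so $T_\phi\mathcal M\simeq\mathbb R^d$. The Fisher matrix is $F_\phi=\mathbb E_{p(x)}\mathbb E_{q_\phi(z\mid x)}[\nabla_\phi\log q_\phi(z\mid x)\nabla_\phi\log q_\phi(z\mid x)^\top]$. Regular means $q_\phi$ is smooth in $\phi$ and $F_\phi$ is well defined, smooth in $\phi$, and positive definite. $\nabla_\phi$ is the Euclidean gradient in coordinates. $\mathrm{grad}\,\mathcal J(\phi)$ is the Riemannian gradient, i.e. the unique tangent vector with $g_\phi(\mathrm{grad}\,\mathcal J(\phi),v)=\mathrm D\mathcal J(\phi)[v]$ for all $v$. $\mathrm{Exp}_\phi$ is the Riemannian exponential map of $g$ (Levi--Civita connection), defined on a neighborhood of $0\in T_\phi\mathcal M$. A retraction at $\phi$ is a smooth map $\mathcal R_\phi$ from a neighborhood of $0\in T_\phi\mathcal M$ to $\mathcal M$ with the two stated properties. *)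

theory Defs
  imports "HOL-Probability.Probability" "HOL-Library.Landau_Symbols"
begin

primrec Ck_on :: "nat \<Rightarrow> 'a::real_normed_vector set \<Rightarrow> ('a \<Rightarrow> 'b::real_normed_vector) \<Rightarrow> bool" where
  "Ck_on 0 S f \<longleftrightarrow> continuous_on S f"
| "Ck_on (Suc k) S f \<longleftrightarrow> (\<forall>x\<in>S. f differentiable (at x)) \<and>
     (\<forall>v. Ck_on k S (\<lambda>x. frechet_derivative f (at x) v))"

text \<open>Only meant for open \<^term>\<open>S\<close>: the derivatives are unrestricted ones.\<close>

definition smooth_on :: "'a::real_normed_vector set \<Rightarrow> ('a \<Rightarrow> 'b::real_normed_vector) \<Rightarrow> bool" where
  "smooth_on S f \<longleftrightarrow> (\<forall>k. Ck_on k S f)"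

definition pderiv_at :: "'d::finite \<Rightarrow> (real^'d \<Rightarrow> real) \<Rightarrow> real^'d \<Rightarrow> real" where
  "pderiv_at i f x = frechet_derivative f (at x) (axis i 1)"

definition euclidean_grad :: "(real^'d::finite \<Rightarrow> real) \<Rightarrow> real^'d \<Rightarrow> real^'d" where
  "euclidean_grad f x = (\<chi> i. pderiv_at i f x)"


section \<open>Riemannian geometry in one global chart\<close>

text \<open>A Riemannian metric on an open set of \<open>real^'d\<close> is given by its matrix field \<open>G\<close>.\<close>

definition metric_of :: "(real^'d::finite \<Rightarrow> real^'d^'d) \<Rightarrow> real^'d \<Rightarrow> real^'d \<Rightarrow> real^'d \<Rightarrow> real" where
  "metric_of G x u v = u \<bullet> (G x *v v)"

definition riemannian_grad ::
    "(real^'d::finite \<Rightarrow> real^'d^'d) \<Rightarrow> (real^'d \<Rightarrow> real) \<Rightarrow> real^'d \<Rightarrow> real^'d" where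
  "riemannian_grad G J x = (THE w. \<forall>v. metric_of G x w v = frechet_derivative J (at x) v)"

text \<open>\<open>christoffel G k i j x\<close> is the symbol \<open>\<Gamma>\<^sup>k\<^sub>i\<^sub>j\<close> at \<open>x\<close> of the Levi-Civita connection of \<open>G\<close>.
  The two lemmas below state that this connection is torsion-free and compatible with \<open>G\<close>.\<close>

definition christoffel ::
    "(real^'d::finite \<Rightarrow> real^'d^'d) \<Rightarrow> 'd \<Rightarrow> 'd \<Rightarrow> 'd \<Rightarrow> real^'d \<Rightarrow> real" where
  "christoffel G k i j x = (1/2) * (\<Sum>l\<in>UNIV. matrix_inv (G x) $ k $ l *
     (pderiv_at i (\<lambda>y. G y $ j $ l) x + pderiv_at j (\<lambda>y. G y $ i $ l) x
      - pderiv_at l (\<lambda>y. G y $ i $ j) x))"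

lemma christoffel_torsion_free:
  assumes "\<And>y. transpose (G y) = G y"
  shows "christoffel G k i j x = christoffel G k j i x"
proof -
  have s: "G y $ a $ b = G y $ b $ a" for y a b
    using assms[of y] by (metis (no_types, lifting) transpose_def vec_lambda_beta)
  have "(\<lambda>y. G y $ i $ j) = (\<lambda>y. G y $ j $ i)" using s by auto
  then show ?thesis
    by (simp add: christoffel_def add.commute)
qed

lemma christoffel_metric_compatible:
  assumes sym: "\<And>y. transpose (G y) = G y" and inv: "invertible (G x)"
  shows "pderiv_at l (\<lambda>y. G y $ i $ j) x =
    (\<Sum>m\<in>UNIV. christoffel G m l i x * G x $ m $ j) + (\<Sum>m\<in>UNIV. christoffel G m l j x * G x $ i $ m)"
proof -
  have s: "G y $ a $ b = G y $ b $ a" for y a b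
    using sym[of y] by (metis (no_types, lifting) transpose_def vec_lambda_beta)
  have s': "(\<lambda>y. G y $ a $ b) = (\<lambda>y. G y $ b $ a)" for a b using s by auto
  have id: "G x ** matrix_inv (G x) = mat 1"
    using inv unfolding invertible_def matrix_inv_def by (metis (mono_tags, lifting) someI_ex)
  have key: "(\<Sum>m\<in>UNIV. (1/2 * (\<Sum>n\<in>UNIV. matrix_inv (G x) $ m $ n * h n)) * G x $ a $ m) = 1/2 * h a"
    for a and h :: "'a \<Rightarrow> real"
  proof -
    have "(\<Sum>m\<in>UNIV. (1/2 * (\<Sum>n\<in>UNIV. matrix_inv (G x) $ m $ n * h n)) * G x $ a $ m)
        = 1/2 * (G x *v (matrix_inv (G x) *v (\<chi> n. h n))) $ a"
      by (simp add: matrix_vector_mult_def sum_distrib_left sum_distrib_right mult_ac)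
    also have "\<dots> = 1/2 * h a"
      by (simp add: matrix_vector_mul_assoc id)
    finally show ?thesis .
  qed
  have "(\<Sum>m\<in>UNIV. christoffel G m l i x * G x $ m $ j) =
     1/2 * (pderiv_at l (\<lambda>y. G y $ i $ j) x + pderiv_at i (\<lambda>y. G y $ l $ j) x - pderiv_at j (\<lambda>y. G y $ l $ i) x)"
    unfolding christoffel_def s[of x _ j] by (rule key)
  moreover have "(\<Sum>m\<in>UNIV. christoffel G m l j x * G x $ i $ m) =
     1/2 * (pderiv_at l (\<lambda>y. G y $ j $ i) x + pderiv_at j (\<lambda>y. G y $ l $ i) x - pderiv_at i (\<lambda>y. G y $ l $ j) x)"
    unfolding christoffel_def by (rule key)
  ultimately show ?thesis
    by (simp add: s'[of j i] algebra_simps)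
qed

text \<open>A geodesic segment in \<open>M\<close> of \<open>G\<close>, parametrised by \<open>{0..1}\<close>, with starting point \<open>x\<close> and
  initial velocity \<open>v\<close>; the function \<open>c\<close> is its velocity field.\<close>

definition geodesic_segment ::
    "(real^'d::finite) set \<Rightarrow> (real^'d \<Rightarrow> real^'d^'d) \<Rightarrow> real^'d \<Rightarrow> real^'d \<Rightarrow> (real \<Rightarrow> real^'d) \<Rightarrow> bool" where
  "geodesic_segment M G x v \<gamma> \<longleftrightarrow> \<gamma> ` {0..1} \<subseteq> M \<and> \<gamma> 0 = x \<and>
     (\<exists>c. c 0 = v \<and> (\<forall>t\<in>{0..1}.
        (\<gamma> has_vector_derivative c t) (at t within {0..1}) \<and>
        (c has_vector_derivative
          (\<chi> k. - (\<Sum>i\<in>UNIV. \<Sum>j\<in>UNIV. christoffel G k i j (\<gamma> t) * c t $ i * c t $ j)))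
          (at t within {0..1})))"

definition exp_domain ::
    "(real^'d::finite) set \<Rightarrow> (real^'d \<Rightarrow> real^'d^'d) \<Rightarrow> real^'d \<Rightarrow> (real^'d) set" where
  "exp_domain M G x = {v. \<exists>\<gamma>. geodesic_segment M G x v \<gamma>}"

text \<open>Meaningful only on \<^const>\<open>exp_domain\<close>.\<close>

definition riemannian_exp ::
    "(real^'d::finite) set \<Rightarrow> (real^'d \<Rightarrow> real^'d^'d) \<Rightarrow> real^'d \<Rightarrow> real^'d \<Rightarrow> real^'d" where
  "riemannian_exp M G x v = (THE y. \<exists>\<gamma>. geodesic_segment M G x v \<gamma> \<and> y = \<gamma> 1)"

text \<open>Retractions in the sense of Riemannian optimisation, unrelated to the topological
  \<^const>\<open>retraction\<close>. The values of \<open>R\<close> outside the neighbourhood \<open>N\<close> are irrelevant.\<close>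

definition retraction_at ::
    "(real^'d::finite) set \<Rightarrow> real^'d \<Rightarrow> (real^'d \<Rightarrow> real^'d) \<Rightarrow> bool" where
  "retraction_at M x R \<longleftrightarrow>
     (\<exists>N. open N \<and> 0 \<in> N \<and> R ` N \<subseteq> M \<and> smooth_on N R) \<and>
     R 0 = x \<and> (R has_derivative (\<lambda>v. v)) (at 0)"


section \<open>Regular statistical manifolds\<close>

text \<open>\<open>q \<phi> x z\<close> is the value at \<open>z\<close> of the density \<open>q\<^sub>\<phi>(z | x)\<close> with respect to a reference
  measure \<open>\<nu>\<close>.\<close>

definition encoder_family ::
    "(real^'d::finite) set \<Rightarrow> 'x measure \<Rightarrow> 'z measure \<Rightarrow> (real^'d \<Rightarrow> 'x \<Rightarrow> 'z \<Rightarrow> real) \<Rightarrow> bool" where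
  "encoder_family \<Theta> P \<nu> q \<longleftrightarrow> prob_space P \<and> sigma_finite_measure \<nu> \<and>
     (\<forall>\<phi>\<in>\<Theta>. (\<lambda>(x, z). q \<phi> x z) \<in> borel_measurable (P \<Otimes>\<^sub>M \<nu>) \<and>
       (\<forall>x\<in>space P. (\<forall>z\<in>space \<nu>. 0 \<le> q \<phi> x z) \<and> (\<integral>\<^sup>+ z. ennreal (q \<phi> x z) \<partial>\<nu>) = 1))"

definition encoder_measure ::
    "'z measure \<Rightarrow> (real^'d::finite \<Rightarrow> 'x \<Rightarrow> 'z \<Rightarrow> real) \<Rightarrow> real^'d \<Rightarrow> 'x \<Rightarrow> 'z measure" where
  "encoder_measure \<nu> q \<phi> x = density \<nu> (\<lambda>z. ennreal (q \<phi> x z))"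

text \<open>No positivity of \<open>q\<close> is needed: points \<open>z\<close> with \<open>q \<phi> x z = 0\<close>, where the score is
  meaningless, form a null set of \<^term>\<open>encoder_measure \<nu> q \<phi> x\<close>.\<close>

definition score ::
    "(real^'d::finite \<Rightarrow> 'x \<Rightarrow> 'z \<Rightarrow> real) \<Rightarrow> real^'d \<Rightarrow> 'x \<Rightarrow> 'z \<Rightarrow> real^'d" where
  "score q \<phi> x z = euclidean_grad (\<lambda>\<psi>. ln (q \<psi> x z)) \<phi>"

definition fisher ::
    "'x measure \<Rightarrow> 'z measure \<Rightarrow> (real^'d::finite \<Rightarrow> 'x \<Rightarrow> 'z \<Rightarrow> real) \<Rightarrow> real^'d \<Rightarrow> real^'d^'d" where
  "fisher P \<nu> q \<phi> = (\<chi> i j. \<integral>x. (\<integral>z. score q \<phi> x z $ i * score q \<phi> x z $ j \<partial>encoder_measure \<nu> q \<phi> x) \<partial>P)"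

definition fisher_well_defined ::
    "'x measure \<Rightarrow> 'z measure \<Rightarrow> (real^'d::finite \<Rightarrow> 'x \<Rightarrow> 'z \<Rightarrow> real) \<Rightarrow> real^'d \<Rightarrow> bool" where
  "fisher_well_defined P \<nu> q \<phi> \<longleftrightarrow> (\<forall>i j.
     (AE x in P. integrable (encoder_measure \<nu> q \<phi> x) (\<lambda>z. score q \<phi> x z $ i * score q \<phi> x z $ j)) \<and>
     integrable P (\<lambda>x. \<integral>z. score q \<phi> x z $ i * score q \<phi> x z $ j \<partial>encoder_measure \<nu> q \<phi> x))"

lemma transpose_fisher: "transpose (fisher P \<nu> q \<phi>) = fisher P \<nu> q \<phi>"
  by (simp add: transpose_def fisher_def vec_eq_iff mult.commute)

text \<open>Positive definiteness omits symmetry, which is automatic by \<open>transpose_fisher\<close>.\<close>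

definition regular_statistical_manifold ::
    "(real^'d::finite) set \<Rightarrow> 'x measure \<Rightarrow> 'z measure \<Rightarrow> (real^'d \<Rightarrow> 'x \<Rightarrow> 'z \<Rightarrow> real) \<Rightarrow> bool" where
  "regular_statistical_manifold \<Theta> P \<nu> q \<longleftrightarrow> open \<Theta> \<and> encoder_family \<Theta> P \<nu> q \<and>
     (\<forall>x\<in>space P. \<forall>z\<in>space \<nu>. smooth_on \<Theta> (\<lambda>\<phi>. q \<phi> x z)) \<and>
     (\<forall>\<phi>\<in>\<Theta>. fisher_well_defined P \<nu> q \<phi>) \<and>
     smooth_on \<Theta> (fisher P \<nu> q) \<and>
     (\<forall>\<phi>\<in>\<Theta>. \<forall>v. v \<noteq> 0 \<longrightarrow> metric_of (fisher P \<nu> q) \<phi> v v > 0)"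

end

(* The exponential map is read off the time-e flow of the geodesic equation, so everything reduces to
   the smooth dependence of this flow on the initial value. This is obtained in one pass from the
   Picard iterates: their spatial derivatives obey an affine recursion whose linear part is a
   contraction by 1/2, so that the iterates converge locally uniformly together with their spatial
   derivatives of every order. Every solution on [0,1] is unique by Gronwall's argument, and the
   homogeneity of geodesics turns Exp(s v) into the geodesic with velocity v at time s, which gives
   D Exp(0) = Id. The O(eta^2) bounds then hold for any retraction, since D R - Id vanishes at 0 and is
   differentiable there. *)
theory Submission
  imports Defs
begin

section \<open>Sequences of time-dependent maps, convergent with their spatial derivatives\<close>

text \<open>Smoothness is wanted on one neighbourhood for all orders at once, so no argument may
  shrink the domain or the time span as the order of differentiation grows. The contraction constant
  1/2 is therefore secured before any differentiation, by multiplying the vector field by a small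
  \<open>\<epsilon>\<close>: differentiating the Picard step repeatedly always leaves the same
  linear part Df(x_n), and the lower-order terms collect in an inhomogeneity. To gain one order,
  only convergence of Df(x_n) to the previous order is required, which the induction supplies. For
  geodesics the factor \<open>\<epsilon>\<close> costs nothing: the acceleration is quadratic in the
  velocity, so slowing down by \<open>\<epsilon>\<close> is compensated by dividing the initial
  velocity by \<open>\<epsilon>\<close>. Time enters only as a continuous parameter, and derivatives
  are taken in one fixed direction at a time; all maps thus stay between Euclidean spaces, in
  keeping with \<open>Ck_on\<close>.\<close>

text \<open>Arguments are pairs of a time in \<open>{0..1}\<close> and a point in space, and only the latter is
  differentiated. A constant sequence expresses the regularity of a single map, so that the closure
  properties below also yield those of \<^const>\<open>Ck_on\<close>, see \<open>Ck_seq_snd_iff\<close>.\<close>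

definition C0_seq :: "'p::euclidean_space set \<Rightarrow> (nat \<Rightarrow> real \<times> 'p \<Rightarrow> 'b::euclidean_space) \<Rightarrow> bool" where
  "C0_seq V x \<longleftrightarrow> (\<forall>n. continuous_on ({0..1} \<times> V) (x n)) \<and>
     (\<forall>C. compact C \<longrightarrow> C \<subseteq> V \<longrightarrow> uniformly_convergent_on ({0..1} \<times> C) x)"

text \<open>The direction is a separate argument: in a fixed direction the derivative again has
  values in \<open>'b\<close>, so it can be differentiated once more without passing to spaces of
  linear maps.\<close>

definition space_deriv ::
    "(real \<times> 'p::euclidean_space \<Rightarrow> 'b::euclidean_space) \<Rightarrow> real \<times> 'p \<Rightarrow> 'p \<Rightarrow> 'b" where
  "space_deriv g z = frechet_derivative (\<lambda>v. g (fst z, v)) (at (snd z))"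

text \<open>Unlike in \<open>Ck_on\<close>, where differentiability gives continuity, the successor
  case has to ask for \<open>C0_seq\<close> separately: convergence of the derivatives does not make
  the maps themselves converge, nor does it give continuity in time.\<close>

primrec Ck_seq ::
    "nat \<Rightarrow> 'p::euclidean_space set \<Rightarrow> (nat \<Rightarrow> real \<times> 'p \<Rightarrow> 'b::euclidean_space) \<Rightarrow> bool" where
  "Ck_seq 0 V x \<longleftrightarrow> C0_seq V x"
| "Ck_seq (Suc k) V x \<longleftrightarrow> C0_seq V x \<and>
     (\<forall>n. \<forall>z\<in>{0..1} \<times> V. (\<lambda>v. x n (fst z, v)) differentiable (at (snd z))) \<and>
     (\<forall>h. Ck_seq k V (\<lambda>n z. space_deriv (x n) z h))"

lemma C0_seq_continuous_on: "C0_seq V x \<Longrightarrow> continuous_on ({0..1} \<times> V) (x n)"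
  by (simp add: C0_seq_def)

lemma Ck_seq_imp_C0_seq: "Ck_seq k V x \<Longrightarrow> C0_seq V x"
  by (cases k) auto

lemma C0_seq_cong:
  assumes "\<And>n z. z \<in> {0..1} \<times> V \<Longrightarrow> x n z = y n z" "C0_seq V x"
  shows "C0_seq V y"
proof -
  have "uniformly_convergent_on ({0..1} \<times> C) y"
    if C: "compact C" "C \<subseteq> V" and u: "uniformly_convergent_on ({0..1} \<times> C) x" for C
    using u
    by (rule iffD1[OF uniformly_convergent_cong, rotated 2])
       (use assms(1) C in \<open>auto intro!: always_eventually\<close>)
  moreover have "continuous_on ({0..1} \<times> V) (y n)" for n
    using C0_seq_continuous_on[OF assms(2), of n] by (rule continuous_on_eq) (use assms(1) in auto)
  ultimately show ?thesis
    using assms(2) by (auto simp: C0_seq_def)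
qed

lemma space_deriv_eqI:
  "((\<lambda>v. g (t, v)) has_derivative g') (at v) \<Longrightarrow> space_deriv g (t, v) = g'"
  by (simp add: space_deriv_def flip: frechet_derivative_at)

lemma Ck_seq_has_derivative:
  assumes "Ck_seq (Suc k) V x" "t \<in> {0..1}" "v \<in> V"
  shows "((\<lambda>v. x n (t, v)) has_derivative space_deriv (x n) (t, v)) (at v)"
proof -
  have "(\<lambda>v. x n (t, v)) differentiable (at v)"
    using assms by auto
  then show ?thesis
    by (simp add: frechet_derivative_works space_deriv_def)
qed

lemma Ck_seq_space_deriv: "Ck_seq (Suc k) V x \<Longrightarrow> Ck_seq k V (\<lambda>n z. space_deriv (x n) z h)"
  by simp

text \<open>Agreement on the open set \<open>V\<close> is agreement near each of its points, so the
  derivatives agree there too.\<close>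

lemma Ck_seq_cong:
  assumes "open V"
  shows "(\<And>n z. z \<in> {0..1} \<times> V \<Longrightarrow> x n z = y n z) \<Longrightarrow> Ck_seq k V x \<Longrightarrow> Ck_seq k V y"
proof (induction k arbitrary: x y)
  case 0
  then show ?case using C0_seq_cong[of V x y] by simp
next
  case (Suc k)
  have D: "((\<lambda>v. y n (t, v)) has_derivative space_deriv (x n) (t, v)) (at v)"
    if "t \<in> {0..1}" "v \<in> V" for n t v
    by (rule has_derivative_transform_within_open[OF Ck_seq_has_derivative[OF Suc.prems(2) that] assms that(2)])
       (use Suc.prems(1) that in auto)
  have "Ck_seq k V (\<lambda>n z. space_deriv (y n) z h)" for h
    by (rule Suc.IH[OF _ Ck_seq_space_deriv[OF Suc.prems(2)]]) (auto simp: space_deriv_eqI[OF D])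
  moreover have "C0_seq V y"
    by (rule C0_seq_cong[OF Suc.prems(1) Ck_seq_imp_C0_seq[OF Suc.prems(2)]])
  moreover have "(\<lambda>v. y n (t, v)) differentiable at v" if "t \<in> {0..1}" "v \<in> V" for n t v
    using D[OF that] by (rule differentiableI)
  ultimately show ?case by auto
qed

text \<open>Lets the closure proofs name an explicit derivative \<open>D\<close> and apply their
  induction hypothesis to it. \<open>space_deriv\<close> is identified with \<open>D\<close> on
  \<open>{0..1} \<times> V\<close> only, which is sufficient by \<open>Ck_seq_cong\<close>.\<close>

lemma Ck_seq_SucI:
  assumes "open V" "C0_seq V x"
    and D: "\<And>n t v. t \<in> {0..1} \<Longrightarrow> v \<in> V \<Longrightarrow> ((\<lambda>v. x n (t, v)) has_derivative D n (t, v)) (at v)"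
    and Ck: "\<And>h. Ck_seq k V (\<lambda>n z. D n z h)"
  shows "Ck_seq (Suc k) V x"
proof -
  have "Ck_seq k V (\<lambda>n z. space_deriv (x n) z h)" for h
    by (rule Ck_seq_cong[OF assms(1) _ Ck]) (auto simp: space_deriv_eqI[OF D])
  moreover have "(\<lambda>v. x n (t, v)) differentiable at v" if "t \<in> {0..1}" "v \<in> V" for n t v
    using D[OF that] by (rule differentiableI)
  ultimately show ?thesis using assms(2) by auto
qed

lemma Ck_seq_Suc_imp: "Ck_seq (Suc k) V x \<Longrightarrow> Ck_seq k V x"
  by (induction k arbitrary: x) auto

section \<open>Closure under products, sums and constants\<close>

lemma C0_seq_bounded_limit:
  assumes "C0_seq V x" "compact C" "C \<subseteq> V" "uniform_limit ({0..1} \<times> C) x l sequentially"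
  shows "bounded (l ` ({0..1} \<times> C))"
proof (rule uniform_limit_bounded[OF assms(4)])
  have "continuous_on ({0..1} \<times> C) (x n)" for n
    by (rule continuous_on_subset[OF C0_seq_continuous_on[OF assms(1)]]) (use assms in auto)
  then show "\<forall>\<^sub>F n in sequentially. bounded (x n ` ({0..1} \<times> C))"
    using assms(2) by (intro always_eventually allI compact_imp_bounded compact_continuous_image
      compact_Times) auto
qed auto

text \<open>Products of uniformly convergent sequences converge uniformly once the limits are
  bounded. On \<open>{0..1} \<times> C\<close> they are, being uniform limits of continuous
  functions on a compact set.\<close>

lemma C0_seq_bilinear:
  assumes "bounded_bilinear pr" "C0_seq V x" "C0_seq V y"
  shows "C0_seq V (\<lambda>n z. pr (x n z) (y n z))"
proof -
  have "uniformly_convergent_on ({0..1} \<times> C) (\<lambda>n z. pr (x n z) (y n z))"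
    if C: "compact C" "C \<subseteq> V" for C
  proof -
    obtain l m where lm: "uniform_limit ({0..1} \<times> C) x l sequentially"
        "uniform_limit ({0..1} \<times> C) y m sequentially"
      using assms C unfolding C0_seq_def uniformly_convergent_on_def by blast
    have "bounded (l ` ({0..1} \<times> C))" "bounded (m ` ({0..1} \<times> C))"
      using C0_seq_bounded_limit assms C lm by blast+
    then show ?thesis
      using bounded_bilinear.bounded_uniform_limit[OF assms(1) lm] uniformly_convergentI by blast
  qed
  then show ?thesis
    using assms by (auto simp: C0_seq_def intro: bounded_bilinear.continuous_on)
qed

lemma C0_seq_add:
  assumes "C0_seq V x" "C0_seq V y"
  shows "C0_seq V (\<lambda>n z. x n z + y n z)"
proof -
  have "uniformly_convergent_on ({0..1} \<times> C) (\<lambda>n z. x n z + y n z)"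
    if C: "compact C" "C \<subseteq> V" for C
  proof -
    obtain l m where "uniform_limit ({0..1} \<times> C) x l sequentially"
        "uniform_limit ({0..1} \<times> C) y m sequentially"
      using assms C unfolding C0_seq_def uniformly_convergent_on_def by blast
    then show ?thesis
      by (intro uniformly_convergentI[OF uniform_limit_add])
  qed
  then show ?thesis
    using assms by (auto simp: C0_seq_def intro: continuous_on_add)
qed

lemma C0_seq_const: "C0_seq V (\<lambda>n z. c)"
  by (auto simp: C0_seq_def)

lemma Ck_seq_const: "open V \<Longrightarrow> Ck_seq k V (\<lambda>n z. c)"
proof (induction k arbitrary: c)
  case (Suc k)
  show ?case
    by (rule Ck_seq_SucI[where D = "\<lambda>n z h. 0"]) (auto intro: Suc C0_seq_const)
qed (auto intro: C0_seq_const)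

lemma Ck_seq_snd: "open V \<Longrightarrow> Ck_seq k V (\<lambda>n z. snd z)"
proof (cases k)
  case (Suc k)
  assume "open V"
  then show ?thesis unfolding Suc
    by (intro Ck_seq_SucI[where D = "\<lambda>n z h. h"])
       (auto intro: Ck_seq_const continuous_intros simp: C0_seq_def)
qed (auto intro: continuous_intros simp: C0_seq_def)

lemma Ck_seq_add:
  "open V \<Longrightarrow> Ck_seq k V x \<Longrightarrow> Ck_seq k V y \<Longrightarrow> Ck_seq k V (\<lambda>n z. x n z + y n z)"
proof (induction k arbitrary: x y)
  case (Suc k)
  show ?case
  proof (rule Ck_seq_SucI[where D = "\<lambda>n z h. space_deriv (x n) z h + space_deriv (y n) z h"])
    fix n t v assume "t \<in> {0..1::real}" "v \<in> V"
    then show "((\<lambda>v. x n (t, v) + y n (t, v)) has_derivative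
      (\<lambda>h. space_deriv (x n) (t, v) h + space_deriv (y n) (t, v) h)) (at v)"
      using Suc.prems by (intro has_derivative_add Ck_seq_has_derivative)
  next
    show "Ck_seq k V (\<lambda>n z. space_deriv (x n) z h + space_deriv (y n) z h)" for h
      using Suc by (intro Suc.IH Ck_seq_space_deriv)
  qed (rule Suc.prems(1) C0_seq_add[OF Ck_seq_imp_C0_seq[OF Suc.prems(2)]
        Ck_seq_imp_C0_seq[OF Suc.prems(3)]])+
qed (auto intro: C0_seq_add)

text \<open>By the product rule the derivative is a sum of two products of the same kind, each with
  one factor differentiated; the other factor drops to order \<open>k\<close> by
  \<open>Ck_seq_Suc_imp\<close>.\<close>

lemma Ck_seq_bilinear:
  assumes "bounded_bilinear pr" "open V"
  shows "Ck_seq k V x \<Longrightarrow> Ck_seq k V y \<Longrightarrow> Ck_seq k V (\<lambda>n z. pr (x n z) (y n z))"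
proof (induction k arbitrary: x y)
  case (Suc k)
  show ?case
  proof (rule Ck_seq_SucI[where
        D = "\<lambda>n z h. pr (x n z) (space_deriv (y n) z h) + pr (space_deriv (x n) z h) (y n z)"])
    fix n t v assume "t \<in> {0..1::real}" "v \<in> V"
    then show "((\<lambda>v. pr (x n (t, v)) (y n (t, v))) has_derivative
      (\<lambda>h. pr (x n (t, v)) (space_deriv (y n) (t, v) h) + pr (space_deriv (x n) (t, v) h) (y n (t, v)))) (at v)"
      using Suc.prems by (intro bounded_bilinear.FDERIV[OF assms(1)] Ck_seq_has_derivative)
  next
    show "Ck_seq k V (\<lambda>n z. pr (x n z) (space_deriv (y n) z h) + pr (space_deriv (x n) z h) (y n z))" for h
      by (intro Ck_seq_add assms(2) Suc.IH Ck_seq_space_deriv[OF Suc.prems(1)]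
          Ck_seq_space_deriv[OF Suc.prems(2)] Ck_seq_Suc_imp[OF Suc.prems(1)]
          Ck_seq_Suc_imp[OF Suc.prems(2)])
  qed (rule assms C0_seq_bilinear[OF assms(1) Ck_seq_imp_C0_seq[OF Suc.prems(1)]
        Ck_seq_imp_C0_seq[OF Suc.prems(2)]])+
qed (auto intro: C0_seq_bilinear[OF assms(1)])

lemma Ck_seq_sum:
  assumes "open V" "\<And>i. i \<in> I \<Longrightarrow> Ck_seq k V (x i)"
  shows "Ck_seq k V (\<lambda>n z. \<Sum>i\<in>I. x i n z)"
  using assms
  by (induction I rule: infinite_finite_induct) (auto intro: Ck_seq_const Ck_seq_add)

section \<open>Composition with a fixed map, and constant sequences\<close>

lemma Ck_on_imp_continuous_on: "Ck_on k U f \<Longrightarrow> continuous_on U f"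
  by (cases k) (auto intro!: differentiable_imp_continuous_on
      simp: differentiable_on_def differentiable_at_withinI)

lemma Ck_on_has_derivative:
  "Ck_on (Suc k) U f \<Longrightarrow> x \<in> U \<Longrightarrow> (f has_derivative frechet_derivative f (at x)) (at x)"
  by (simp add: frechet_derivative_works)

text \<open>Continuity of \<open>f\<close> upgrades to uniform continuity only on a compact set, so
  the values of all members of the sequence over \<open>C\<close> have to lie in one compact
  \<open>K\<close> inside \<open>U\<close>.\<close>

lemma C0_seq_compose:
  assumes "continuous_on U f" "C0_seq V x"
    and K: "\<And>C. compact C \<Longrightarrow> C \<subseteq> V \<Longrightarrow> \<exists>K. compact K \<and> K \<subseteq> U \<and> (\<forall>n. x n ` ({0..1} \<times> C) \<subseteq> K)"
  shows "C0_seq V (\<lambda>n z. f (x n z))"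
proof -
  have "uniformly_convergent_on ({0..1} \<times> C) (\<lambda>n z. f (x n z))" if C: "compact C" "C \<subseteq> V" for C
  proof -
    obtain K where K: "compact K" "K \<subseteq> U" "\<And>n. x n ` ({0..1} \<times> C) \<subseteq> K"
      using K[OF C] by auto
    show ?thesis
    proof (rule uniformly_convergent_on_compose_uniformly_continuous_on[where f = f and B = K])
      show "uniformly_continuous_on K f"
        by (intro compact_uniformly_continuous[OF continuous_on_subset[OF assms(1) K(2)] K(1)])
      show "closed K" using K compact_imp_closed by blast
      show "uniformly_convergent_on ({0..1} \<times> C) x" using assms C by (auto simp: C0_seq_def)
      show "\<forall>\<^sub>F n in sequentially. \<forall>y\<in>{0..1} \<times> C. x n y \<in> K"
        using K(3) by (intro always_eventually) blast
    qed
  qed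
  moreover have "x n z \<in> U" if "z \<in> {0..1} \<times> V" for n z
    using K[of "{snd z}"] that by force
  then have "continuous_on ({0..1} \<times> V) (\<lambda>z. f (x n z))" for n
    by (intro continuous_on_compose2[OF assms(1) C0_seq_continuous_on[OF assms(2)]]) auto
  ultimately show ?thesis by (auto simp: C0_seq_def)
qed

lemma linear_eq_sum_Basis:
  fixes f :: "'a::euclidean_space \<Rightarrow> 'b::real_vector"
  assumes "linear f"
  shows "f w = (\<Sum>b\<in>Basis. (w \<bullet> b) *\<^sub>R f b)"
proof -
  have "f (\<Sum>b\<in>Basis. (w \<bullet> b) *\<^sub>R b) = (\<Sum>b\<in>Basis. (w \<bullet> b) *\<^sub>R f b)"
    by (simp add: linear_sum[OF assms] linear_scale[OF assms] del: euclidean_representation)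
  then show ?thesis by (simp add: euclidean_representation)
qed

lemma Ck_seq_compose:
  fixes f :: "'a::euclidean_space \<Rightarrow> 'b::euclidean_space"
  assumes V: "open V"
  shows "Ck_on k U f \<Longrightarrow> Ck_seq k V x \<Longrightarrow>
    (\<And>C. compact C \<Longrightarrow> C \<subseteq> V \<Longrightarrow> \<exists>K. compact K \<and> K \<subseteq> U \<and> (\<forall>n. x n ` ({0..1} \<times> C) \<subseteq> K)) \<Longrightarrow>
    Ck_seq k V (\<lambda>n z. f (x n z))"
proof (induction k arbitrary: f x)
  case 0
  then show ?case using C0_seq_compose[of U f V x] by simp
next
  case (Suc k)
  have U: "x n z \<in> U" if "z \<in> {0..1} \<times> V" for n z
    using Suc.prems(3)[of "{snd z}"] that by force
  \<comment> \<open>The chain rule, expanded in a basis: the direction in which \<open>f\<close> is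
    differentiated depends on \<open>n\<close> and \<open>z\<close>, whereas the induction
    hypothesis covers the derivatives of \<open>f\<close> along a fixed \<open>b\<close>.\<close>
  define D where "D n z h = (\<Sum>b\<in>Basis. (space_deriv (x n) z h \<bullet> b) *\<^sub>R
      frechet_derivative f (at (x n z)) b)" for n z h
  show ?case
  proof (rule Ck_seq_SucI[OF V])
    show "C0_seq V (\<lambda>n z. f (x n z))"
      by (rule C0_seq_compose[OF Ck_on_imp_continuous_on[OF Suc.prems(1)]
            Ck_seq_imp_C0_seq[OF Suc.prems(2)] Suc.prems(3)])
  next
    fix n t v assume tv: "t \<in> {0..1::real}" "v \<in> V"
    have "linear (frechet_derivative f (at (x n (t, v))))"
      using Ck_on_has_derivative[OF Suc.prems(1) U] tv has_derivative_linear by blast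
    then have "frechet_derivative f (at (x n (t, v))) w =
        (\<Sum>b\<in>Basis. (w \<bullet> b) *\<^sub>R frechet_derivative f (at (x n (t, v))) b)" for w
      by (rule linear_eq_sum_Basis)
    then have "D n (t, v) = (\<lambda>h. frechet_derivative f (at (x n (t, v))) (space_deriv (x n) (t, v) h))"
      unfolding D_def by (intro ext) (rule sym)
    then show "((\<lambda>v. f (x n (t, v))) has_derivative D n (t, v)) (at v)"
      using has_derivative_compose[OF Ck_seq_has_derivative[OF Suc.prems(2) tv]
          Ck_on_has_derivative[OF Suc.prems(1) U]] tv by auto
  next
    fix h
    have "Ck_seq k V (\<lambda>n z. frechet_derivative f (at (x n z)) b)" for b
      by (rule Suc.IH[OF _ Ck_seq_Suc_imp[OF Suc.prems(2)] Suc.prems(3)])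
         (use Suc.prems(1) in auto)
    then show "Ck_seq k V (\<lambda>n z. D n z h)"
      unfolding D_def
      by (intro Ck_seq_sum V Ck_seq_bilinear[OF bounded_bilinear_scaleR]
          Ck_seq_bilinear[OF bounded_bilinear_inner] Ck_seq_const Ck_seq_space_deriv[OF Suc.prems(2)])
  qed
qed

lemma Ck_seq_snd_iff:
  fixes f :: "'a::euclidean_space \<Rightarrow> 'b::euclidean_space"
  assumes "open V"
  shows "Ck_seq k V (\<lambda>n z. f (snd z)) \<longleftrightarrow> Ck_on k V f"
proof -
  have C0: "C0_seq V (\<lambda>n z. f (snd z)) \<longleftrightarrow> continuous_on V f" for f :: "'a \<Rightarrow> 'b"
  proof
    assume "C0_seq V (\<lambda>n z. f (snd z))"
    from C0_seq_continuous_on[OF this]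
    have "continuous_on V (\<lambda>v. f (snd (0::real, v)))"
      by (rule continuous_on_compose2) (auto intro!: continuous_intros)
    then show "continuous_on V f" by simp
  qed (auto simp: C0_seq_def intro!: continuous_on_compose2[of V f] continuous_intros)
  have sd: "space_deriv (\<lambda>z. f (snd z)) z h = frechet_derivative f (at (snd z)) h"
    for f :: "'a \<Rightarrow> 'b" and z :: "real \<times> 'a" and h
    by (simp add: space_deriv_def)
  show ?thesis
  proof (induction k arbitrary: f)
    case (Suc k)
    have C: "Ck_on (Suc k) V f \<Longrightarrow> C0_seq V (\<lambda>n z. f (snd z))"
      using Ck_on_imp_continuous_on C0 by blast
    have iff: "Ck_seq k V (\<lambda>n z. space_deriv (\<lambda>z. f (snd z)) z h) \<longleftrightarrow>
        Ck_on k V (\<lambda>x. frechet_derivative f (at x) h)" for h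
      unfolding sd by (rule Suc)
    have all: "(\<forall>z\<in>{0..1::real} \<times> V. P (snd z)) \<longleftrightarrow> (\<forall>x\<in>V. P x)" for P
      by auto
    show ?case
      using C unfolding Ck_seq.simps Ck_on.simps iff snd_conv all[of "\<lambda>x. f differentiable at x"]
      by blast
  qed (simp add: C0)
qed

section \<open>Integration in time and differentiation under the integral sign\<close>

text \<open>The integral of \<open>g\<close> over \<open>{0..t}\<close> (see \<open>time_integral_eq_integral\<close>), rescaled to a fixed interval
  so that theorems on parametric integrals apply.\<close>

definition time_integral ::
    "(real \<times> 'p::euclidean_space \<Rightarrow> 'b::euclidean_space) \<Rightarrow> real \<times> 'p \<Rightarrow> 'b" where
  "time_integral g z = fst z *\<^sub>R integral {0..1} (\<lambda>s. g (fst z * s, snd z))"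

lemma continuous_on_time_scale:
  fixes g :: "real \<times> 'p::euclidean_space \<Rightarrow> 'b::euclidean_space"
  assumes "continuous_on ({0..1} \<times> V) g" "z \<in> {0..1} \<times> V"
  shows "continuous_on {0..1} (\<lambda>s. g (fst z * s, snd z))"
  by (rule continuous_on_compose2[OF assms(1)])
     (use assms(2) in \<open>auto intro!: continuous_intros continuous_on_mult_left
        simp: mult_le_one\<close>)

lemma continuous_on_time_integral:
  assumes "continuous_on ({0..1} \<times> V) g"
  shows "continuous_on ({0..1} \<times> V) (time_integral g)"
proof -
  have "continuous_on (({0..1} \<times> V) \<times> cbox 0 1) (\<lambda>(z, s). g (fst z * s, snd z))"
    unfolding split_beta
    by (rule continuous_on_compose2[OF assms])
       (auto intro!: continuous_intros continuous_on_mult_left simp: mult_le_one)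
  from integral_continuous_on_param[OF this] show ?thesis
    unfolding time_integral_def by (auto intro!: continuous_intros simp: cbox_interval)
qed

lemma time_integral_norm_le:
  assumes "continuous_on ({0..1} \<times> V) g" "z \<in> {0..1} \<times> V"
    and "\<And>t. t \<in> {0..1} \<Longrightarrow> norm (g (t, snd z)) \<le> B"
  shows "norm (time_integral g z) \<le> B"
proof -
  have "norm (integral {0..1} (\<lambda>s. g (fst z * s, snd z))) \<le> B * (1 - 0)"
  proof (rule integral_bound)
    show "norm (g (fst z * s, snd z)) \<le> B" if "s \<in> {0..1}" for s
      using assms(2) that by (intro assms(3)) (auto simp: mult_le_one)
  qed (use continuous_on_time_scale[OF assms(1,2)] in auto)
  \<comment> \<open>Needed to drop the factor \<open>fst z\<close>, which is at most 1.\<close>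
  moreover have "0 \<le> B"
    using order_trans[OF norm_ge_zero assms(3)[of 0]] by simp
  ultimately have "\<bar>fst z\<bar> * norm (integral {0..1} (\<lambda>s. g (fst z * s, snd z))) \<le> 1 * B"
    using assms(2) by (intro mult_mono) auto
  then show ?thesis
    by (simp add: time_integral_def)
qed

lemma time_integral_diff:
  assumes "continuous_on ({0..1} \<times> V) g" "continuous_on ({0..1} \<times> V) h" "z \<in> {0..1} \<times> V"
  shows "time_integral g z - time_integral h z = time_integral (\<lambda>z. g z - h z) z"
  using continuous_on_time_scale[OF assms(1,3)] continuous_on_time_scale[OF assms(2,3)]
  unfolding time_integral_def
  by (subst integral_diff) (auto intro: integrable_continuous_real simp: scaleR_diff_right)

lemma time_integral_add:
  assumes "continuous_on ({0..1} \<times> V) g" "continuous_on ({0..1} \<times> V) h" "z \<in> {0..1} \<times> V"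
  shows "time_integral (\<lambda>z. g z + h z) z = time_integral g z + time_integral h z"
  using continuous_on_time_scale[OF assms(1,3)] continuous_on_time_scale[OF assms(2,3)]
  unfolding time_integral_def
  by (subst integral_add) (auto intro: integrable_continuous_real simp: scaleR_add_right)

text \<open>Integration over a time span of at most 1 does not increase a bound that is uniform in
  time, so it preserves uniform limits.\<close>

lemma uniform_limit_time_integral:
  assumes l: "uniform_limit ({0..1} \<times> C) x l sequentially"
    and cx: "\<And>n. continuous_on ({0..1} \<times> C) (x n)"
  shows "uniform_limit ({0..1} \<times> C) (\<lambda>n. time_integral (x n)) (time_integral l) sequentially"
proof (rule uniform_limitI)
  have cl: "continuous_on ({0..1} \<times> C) l"
    by (rule uniform_limit_theorem[OF _ l]) (use cx in auto)
  fix e :: real assume "e > 0"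
  \<comment> \<open>Half of \<open>e\<close>, since the norm estimate for the integral is not
    strict.\<close>
  then have "\<forall>\<^sub>F n in sequentially. \<forall>z\<in>{0..1} \<times> C. dist (x n z) (l z) < e/2"
    using l by (intro uniform_limitD) auto
  then show "\<forall>\<^sub>F n in sequentially. \<forall>z\<in>{0..1} \<times> C. dist (time_integral (x n) z) (time_integral l z) < e"
  proof (eventually_elim, safe)
    fix n t v assume *: "\<forall>z\<in>{0..1} \<times> C. dist (x n z) (l z) < e/2" "t \<in> {0..1::real}" "v \<in> C"
    have "norm (time_integral (\<lambda>z. x n z - l z) (t, v)) \<le> e/2"
      by (rule time_integral_norm_le[of C])
         (use * cx cl in \<open>auto intro!: continuous_intros simp: dist_norm less_imp_le\<close>)
    then show "dist (time_integral (x n) (t, v)) (time_integral l (t, v)) < e"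
      using time_integral_diff[OF cx cl, of "(t, v)"] * \<open>e > 0\<close> by (simp add: dist_norm)
  qed
qed

lemma C0_seq_time_integral:
  assumes "C0_seq V x"
  shows "C0_seq V (\<lambda>n. time_integral (x n))"
proof -
  have "uniformly_convergent_on ({0..1} \<times> C) (\<lambda>n. time_integral (x n))" if C: "compact C" "C \<subseteq> V" for C
  proof -
    obtain l where l: "uniform_limit ({0..1} \<times> C) x l sequentially"
      using assms C unfolding C0_seq_def uniformly_convergent_on_def by blast
    have "continuous_on ({0..1} \<times> C) (x n)" for n
      by (rule continuous_on_subset[OF C0_seq_continuous_on[OF assms]]) (use C in auto)
    from uniformly_convergentI[OF uniform_limit_time_integral[OF l this]] show ?thesis .
  qed
  then show ?thesis
    using assms by (auto simp: C0_seq_def intro: continuous_on_time_integral)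
qed

lemma time_integral_has_derivative:
  assumes "open V" and g: "continuous_on ({0..1} \<times> V) g"
    and D: "\<And>t v. t \<in> {0..1} \<Longrightarrow> v \<in> V \<Longrightarrow> ((\<lambda>v. g (t, v)) has_derivative g' (t, v)) (at v)"
    and g': "\<And>h. continuous_on ({0..1} \<times> V) (\<lambda>z. g' z h)"
    and tv: "t \<in> {0..1}" "v \<in> V"
  shows "((\<lambda>v. time_integral g (t, v)) has_derivative (\<lambda>h. time_integral (\<lambda>z. g' z h) (t, v))) (at v)"
proof -
  \<comment> \<open>A ball, because \<open>leibniz_rule\<close> needs a convex parameter
    set.\<close>
  obtain r where r: "r > 0" "ball v r \<subseteq> V"
    using assms(1) tv(2) open_contains_ball by blast
  define B where "B w s = Blinfun (g' (t * s, w))" for w s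
  have B: "blinfun_apply (B w s) = g' (t * s, w)" if "w \<in> V" "s \<in> {0..1}" for w s
    unfolding B_def
    by (rule bounded_linear_Blinfun_apply has_derivative_bounded_linear D)+
       (use that tv in \<open>auto simp: mult_le_one\<close>)
  \<comment> \<open>In finite dimension, continuity in every direction gives continuity in operator
    norm.\<close>
  have cB: "continuous_on (V \<times> {0..1}) (\<lambda>(w, s). B w s)"
  proof (rule continuous_on_blinfun_componentwise)
    fix h :: 'a
    have "continuous_on (V \<times> {0..1}) (\<lambda>p. g' (t * snd p, fst p) h)"
      by (rule continuous_on_compose2[OF g'])
         (use tv in \<open>auto intro!: continuous_intros continuous_on_mult_left
        simp: mult_le_one\<close>)
    then show "continuous_on (V \<times> {0..1}) (\<lambda>p. blinfun_apply (case p of (w, s) \<Rightarrow> B w s) h)"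
      by (rule continuous_on_eq) (auto simp: B)
  qed
  have "((\<lambda>v. integral (cbox 0 1) (\<lambda>s. g (t * s, v))) has_derivative integral (cbox 0 1) (B v)) (at v within ball v r)"
  proof (rule leibniz_rule)
    fix w s assume "w \<in> ball v r" "s \<in> cbox 0 (1::real)"
    then have ws: "w \<in> V" "s \<in> {0..1}" using r by auto
    show "((\<lambda>v. g (t * s, v)) has_derivative blinfun_apply (B w s)) (at w within ball v r)"
      unfolding B[OF ws] by (rule has_derivative_at_withinI, rule D) (use tv ws in \<open>auto simp: mult_le_one\<close>)
  next
    fix w assume "w \<in> ball v r"
    then have "(t, w) \<in> {0..1} \<times> V" using r tv by auto
    from continuous_on_time_scale[OF g this]
    show "(\<lambda>s. g (t * s, w)) integrable_on cbox 0 1"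
      unfolding fst_conv snd_conv cbox_interval by (rule integrable_continuous_real)
  next
    show "continuous_on (ball v r \<times> cbox 0 1) (\<lambda>(x, s). B x s)"
      by (rule continuous_on_subset[OF cB]) (use r in auto)
  qed (use r in auto)
  then have "((\<lambda>v. integral {0..1} (\<lambda>s. g (t * s, v))) has_derivative integral {0..1} (B v)) (at v)"
    using r at_within_open[of v "ball v r"] by (simp add: cbox_interval)
  then have "((\<lambda>v. t *\<^sub>R integral {0..1} (\<lambda>s. g (t * s, v))) has_derivative (\<lambda>h. t *\<^sub>R integral {0..1} (B v) h)) (at v)"
    by (rule has_derivative_scaleR_right)
  moreover have "blinfun_apply (integral {0..1} (B v)) h = integral {0..1} (\<lambda>s. g' (t * s, v) h)" for h
  proof -
    have "continuous_on {0..1} (\<lambda>s. case (v, s) of (w, s) \<Rightarrow> B w s)"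
      by (rule continuous_on_compose2[OF cB]) (use tv in \<open>auto intro!: continuous_intros\<close>)
    then have "blinfun_apply (integral {0..1} (B v)) h = integral {0..1} (\<lambda>s. B v s h)"
      by (intro blinfun_apply_integral integrable_continuous_real) simp
    also have "\<dots> = integral {0..1} (\<lambda>s. g' (t * s, v) h)"
      by (rule integral_cong) (use tv in \<open>simp add: B\<close>)
    finally show ?thesis .
  qed
  ultimately show ?thesis
    by (simp add: time_integral_def)
qed

lemma Ck_seq_time_integral:
  assumes "open V"
  shows "Ck_seq k V x \<Longrightarrow> Ck_seq k V (\<lambda>n. time_integral (x n))"
proof (induction k arbitrary: x)
  case (Suc k)
  show ?case
  proof (rule Ck_seq_SucI[OF assms])
    show "C0_seq V (\<lambda>n. time_integral (x n))"
      using Suc.prems Ck_seq_imp_C0_seq C0_seq_time_integral by blast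
    show "((\<lambda>v. time_integral (x n) (t, v)) has_derivative
        (\<lambda>h. time_integral (\<lambda>z. space_deriv (x n) z h) (t, v))) (at v)"
      if "t \<in> {0..1}" "v \<in> V" for n t v
      using that Suc.prems assms
      by (intro time_integral_has_derivative[of V]) (auto intro!: Ck_seq_has_derivative
          C0_seq_continuous_on Ck_seq_imp_C0_seq Ck_seq_space_deriv
          simp del: Ck_seq.simps dest: Ck_seq_space_deriv)
    show "Ck_seq k V (\<lambda>n z. time_integral (\<lambda>z. space_deriv (x n) z h) z)" for h
      using Suc.IH[OF Ck_seq_space_deriv[OF Suc.prems]] by simp
  qed
qed (simp add: C0_seq_time_integral)

section \<open>Perturbed contractions and affine recursions\<close>

text \<open>The hypothesis speaks of every upper bound \<open>D\<close> so that no supremum occurs,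
  and \<open>e\<close> allows for recursions whose coefficients still vary with \<open>n\<close>.
  From the trivial bound \<open>2 * B\<close>, repeated passage from \<open>D\<close> to
  \<open>e/4 + D/2\<close> drives the distance of late members towards the fixed point
  \<open>e/2\<close>.\<close>

lemma uniformly_convergent_on_half_contraction:
  fixes y :: "nat \<Rightarrow> 's \<Rightarrow> 'b::banach"
  assumes bound: "\<And>n s. s \<in> S \<Longrightarrow> norm (y n s) \<le> B"
    and step: "\<And>e. e > 0 \<Longrightarrow> \<exists>N. \<forall>m\<ge>N. \<forall>n\<ge>N. \<forall>D. (\<forall>s\<in>S. norm (y m s - y n s) \<le> D) \<longrightarrow>
      (\<forall>s\<in>S. norm (y (Suc m) s - y (Suc n) s) \<le> e + D/2)"
  shows "uniformly_convergent_on S y"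
proof -
  have "uniformly_Cauchy_on S y"
  proof (rule uniformly_Cauchy_onI)
    fix e :: real assume "e > 0"
    then obtain N where N: "\<And>m n D s. N \<le> m \<Longrightarrow> N \<le> n \<Longrightarrow> (\<forall>s\<in>S. norm (y m s - y n s) \<le> D) \<Longrightarrow>
        s \<in> S \<Longrightarrow> norm (y (Suc m) s - y (Suc n) s) \<le> e/4 + D/2"
      using step[of "e/4"] by (metis zero_less_divide_iff zero_less_numeral)
    have *: "\<forall>s\<in>S. norm (y m s - y n s) \<le> e/2 + 2*B/2^j" if "N + j \<le> m" "N + j \<le> n" for m n j
      using that
    proof (induction j arbitrary: m n)
      case 0
      have "norm (y m s - y n s) \<le> e/2 + 2*B" if "s \<in> S" for s
        using norm_triangle_ineq4[of "y m s" "y n s"] bound[OF that, of m] bound[OF that, of n] \<open>e > 0\<close>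
        by linarith
      then show ?case by simp
    next
      case (Suc j)
      obtain m' n' where mn: "m = Suc m'" "n = Suc n'"
        using Suc.prems by (metis Suc_le_D add_Suc_right)
      have "\<forall>s\<in>S. norm (y m' s - y n' s) \<le> e/2 + 2*B/2^j"
        using Suc.prems mn by (intro Suc.IH) auto
      then have "norm (y m s - y n s) \<le> e/4 + (e/2 + 2*B/2^j)/2" if "s \<in> S" for s
        unfolding mn using Suc.prems mn that by (intro N) auto
      moreover have "e/4 + (e/2 + 2*B/2^j)/2 = e/2 + 2*B/2^Suc j"
        by (simp add: field_simps)
      ultimately show ?case by metis
    qed
    have "(\<lambda>j. 2 * B * (1/2)^j) \<longlonglongrightarrow> 2 * B * 0"
      by (intro tendsto_intros LIMSEQ_abs_realpow_zero2) auto
    then have "\<forall>\<^sub>F j in sequentially. 2 * B * (1/2)^j < e/2"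
      using \<open>e > 0\<close> by (intro order_tendstoD(2)[of _ 0]) auto
    then obtain j where "2 * B * (1/2)^j < e/2"
      using eventually_happens sequentially_bot by blast
    then have "\<forall>s\<in>S. \<forall>m\<ge>N + j. \<forall>n\<ge>N + j. dist (y m s) (y n s) < e"
      using *[of j] unfolding dist_norm power_one_over by fastforce
    then show "\<exists>M. \<forall>s\<in>S. \<forall>m\<ge>M. \<forall>n\<ge>M. dist (y m s) (y n s) < e" by blast
  qed
  then show ?thesis by (rule Cauchy_uniformly_convergent)
qed

text \<open>A bound for the limit serves all but finitely many members up to an error of 1, and
  compactness bounds each of the others.\<close>

lemma C0_seq_uniformly_bounded:
  assumes "C0_seq V x" "compact C" "C \<subseteq> V"
  obtains B where "\<And>n z. z \<in> {0..1} \<times> C \<Longrightarrow> norm (x n z) \<le> B"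
proof -
  obtain l where l: "uniform_limit ({0..1} \<times> C) x l sequentially"
    using assms unfolding C0_seq_def uniformly_convergent_on_def by blast
  obtain B0 where B0: "\<And>z. z \<in> {0..1} \<times> C \<Longrightarrow> norm (l z) \<le> B0"
    using C0_seq_bounded_limit[OF assms l] unfolding bounded_iff by blast
  obtain N where N: "\<And>n z. n \<ge> N \<Longrightarrow> z \<in> {0..1} \<times> C \<Longrightarrow> dist (x n z) (l z) < 1"
    using l unfolding uniform_limit_sequentially_iff by (meson zero_less_one)
  have "compact (x n ` ({0..1} \<times> C))" for n
    by (intro compact_continuous_image compact_Times
        continuous_on_subset[OF C0_seq_continuous_on[OF assms(1)]]) (use assms in auto)
  then have "bounded (\<Union>n<N. x n ` ({0..1} \<times> C))"
    by (intro bounded_UN compact_imp_bounded ballI) auto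
  then obtain B1 where B1: "\<And>n z. n < N \<Longrightarrow> z \<in> {0..1} \<times> C \<Longrightarrow> norm (x n z) \<le> B1"
    unfolding bounded_iff by blast
  have "norm (x n z) \<le> max B1 (B0 + 1)" if "z \<in> {0..1} \<times> C" for n z
  proof (cases "n < N")
    case True
    then show ?thesis using B1[OF True that] by simp
  next
    case False
    then show ?thesis
      using N[of n z] B0[OF that] that norm_triangle_ineq2[of "x n z" "l z"] by (auto simp: dist_norm)
  qed
  then show ?thesis by (rule that)
qed

text \<open>After a step, the distance of two members splits into half their previous distance and
  the effect of \<open>a\<close> and \<open>b\<close> not having settled yet, which the boundedness
  of \<open>y\<close> makes small. This is the situation of
  \<open>uniformly_convergent_on_half_contraction\<close>.\<close>

lemma C0_seq_recursion:
  fixes y :: "nat \<Rightarrow> real \<times> 'p::euclidean_space \<Rightarrow> 'a::euclidean_space"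
  assumes y: "\<And>n. continuous_on ({0..1} \<times> V) (y n)" and b: "C0_seq V b"
    and a: "\<And>\<beta>. \<beta> \<in> Basis \<Longrightarrow> C0_seq V (a \<beta>)"
    and small: "\<And>n z w. z \<in> {0..1} \<times> V \<Longrightarrow> norm (\<Sum>\<beta>\<in>Basis. (w \<bullet> \<beta>) *\<^sub>R a \<beta> n z) \<le> norm w / 2"
    and rec: "\<And>n z. z \<in> {0..1} \<times> V \<Longrightarrow>
      y (Suc n) z = b n z + time_integral (\<lambda>z. \<Sum>\<beta>\<in>Basis. (y n z \<bullet> \<beta>) *\<^sub>R a \<beta> n z) z"
  shows "C0_seq V y"
proof -
  have "uniformly_convergent_on ({0..1} \<times> C) y" if C: "compact C" "C \<subseteq> V" for C
  proof -
    let ?S = "{0..1::real} \<times> C"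
    define A where "A n w z = (\<Sum>\<beta>\<in>Basis. (w \<bullet> \<beta>) *\<^sub>R a \<beta> n z)" for n w z
    have cy: "continuous_on ?S (y n)" for n
      by (rule continuous_on_subset[OF y]) (use C in auto)
    have ca: "continuous_on ?S (a \<beta> n)" if "\<beta> \<in> Basis" for \<beta> n
      by (rule continuous_on_subset[OF C0_seq_continuous_on[OF a[OF that]]]) (use C in auto)
    have cA: "continuous_on ?S (\<lambda>z. A n (y n z) z)" for n
      unfolding A_def by (intro continuous_intros cy ca)
    have rec': "y (Suc n) z = b n z + time_integral (\<lambda>z. A n (y n z) z) z" if "z \<in> ?S" for n z
      using that C unfolding A_def by (intro rec) auto
    have small': "norm (A n w z) \<le> norm w / 2" if "z \<in> ?S" for n w z
      using that C unfolding A_def by (intro small) auto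
    obtain Bb where Bb: "\<And>n z. z \<in> ?S \<Longrightarrow> norm (b n z) \<le> Bb"
      using C0_seq_uniformly_bounded[OF b C] by blast
    obtain B0 where B0: "\<And>z. z \<in> ?S \<Longrightarrow> norm (y 0 z) \<le> B0"
      using compact_imp_bounded[OF compact_continuous_image[OF cy[of 0]]] C
      unfolding bounded_iff by (auto simp: compact_Times)
    \<comment> \<open>\<open>2 * Bb\<close> makes the bound invariant under a step, as
      \<open>Bb + B/2 \<le> B\<close>; \<open>B0\<close> covers the start.\<close>
    define B where "B = max 0 (max (2 * Bb) B0)"
    have yB: "norm (y n z) \<le> B" if "z \<in> ?S" for n z
      using that
    proof (induction n arbitrary: z)
      case 0
      then show ?case using B0[of z] by (auto simp: B_def)
    next
      case (Suc n)
      have "norm (A n (y n (t, snd z)) (t, snd z)) \<le> B/2" if "t \<in> {0..1}" for t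
        using small'[of "(t, snd z)" n "y n (t, snd z)"] Suc.IH[of "(t, snd z)"] Suc.prems that by auto
      then have "norm (time_integral (\<lambda>z. A n (y n z) z) z) \<le> B/2"
        by (rule time_integral_norm_le[OF cA Suc.prems])
      then show ?case
        using Bb[OF Suc.prems, of n] unfolding rec'[OF Suc.prems] B_def
        by (intro norm_triangle_le) auto
    qed
    show ?thesis
    proof (rule uniformly_convergent_on_half_contraction[OF yB])
      fix e :: real assume "e > 0"
      \<comment> \<open>Chosen so that the \<open>DIM('a)\<close> coefficient errors, each at most
        \<open>B * e'\<close>, add up to at most \<open>e/2\<close>; the \<open>+ 1\<close> keeps
        \<open>c\<close> positive.\<close>
      define c where "c = 2 * (B + 1) * DIM('a)"
      define e' where "e' = e / c"
      have "B \<ge> 0" by (simp add: B_def)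
      then have "c > 0" by (auto simp: c_def intro!: mult_pos_pos)
      then have e': "e' > 0" using \<open>e > 0\<close> by (simp add: e'_def)
      have "B * e' \<le> (B + 1) * e'" using e' by simp
      then have "DIM('a) * (B * e') \<le> DIM('a) * ((B + 1) * e')"
        by (rule mult_left_mono) simp
      also have "\<dots> = c * e' / 2" by (simp add: c_def)
      also have "\<dots> = e/2" using \<open>c > 0\<close> by (simp add: e'_def)
      finally have e'e: "DIM('a) * (B * e') \<le> e/2" .
      have Cauchy: "\<exists>N. \<forall>m\<ge>N. \<forall>n\<ge>N. \<forall>z\<in>?S. norm (x m z - x n z) \<le> d"
        if "C0_seq V x" "d > 0" for x :: "nat \<Rightarrow> real \<times> 'p \<Rightarrow> 'a" and d
      proof -
        have "uniformly_Cauchy_on ?S x"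
          using that C by (auto simp: C0_seq_def uniformly_convergent_eq_Cauchy)
        from this[unfolded uniformly_Cauchy_on_def, rule_format, OF that(2)]
        show ?thesis unfolding dist_norm by (meson less_imp_le)
      qed
      obtain N1 where N1: "\<And>m n z. m \<ge> N1 \<Longrightarrow> n \<ge> N1 \<Longrightarrow> z \<in> ?S \<Longrightarrow> norm (b m z - b n z) \<le> e/2"
        using Cauchy[OF b half_gt_zero[OF \<open>e > 0\<close>]] by blast
      have "\<forall>\<beta>\<in>Basis. \<exists>N. \<forall>m\<ge>N. \<forall>n\<ge>N. \<forall>z\<in>?S. norm (a \<beta> m z - a \<beta> n z) \<le> e'"
        using Cauchy[OF a e'] by blast
      then obtain Nf where Nf: "\<And>\<beta> m n z. \<beta> \<in> Basis \<Longrightarrow> m \<ge> Nf \<beta> \<Longrightarrow> n \<ge> Nf \<beta> \<Longrightarrow> z \<in> ?S \<Longrightarrow>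
          norm (a \<beta> m z - a \<beta> n z) \<le> e'"
        by (fastforce dest!: bchoice)
      \<comment> \<open>A sum of natural numbers bounds each of the finitely many thresholds from
        above.\<close>
      define N where "N = N1 + (\<Sum>\<beta>\<in>Basis. Nf \<beta>)"
      have NfN: "Nf \<beta> \<le> N" if "\<beta> \<in> Basis" for \<beta>
        unfolding N_def using member_le_sum[OF that, of Nf] by simp
      have "norm (y (Suc m) z - y (Suc n) z) \<le> e + D/2"
        if mn: "N \<le> m" "N \<le> n" and D: "\<forall>z\<in>?S. norm (y m z - y n z) \<le> D" and z: "z \<in> ?S" for m n D z
      proof -
        have "norm (A m (y m (t, snd z)) (t, snd z) - A n (y n (t, snd z)) (t, snd z)) \<le> e/2 + D/2"
          if "t \<in> {0..1}" for t
        proof -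
          let ?z = "(t, snd z)"
          have tz: "?z \<in> ?S" using that z by auto
          \<comment> \<open>The coefficients change under the fixed argument \<open>y m\<close>, and
            the argument changes under the fixed contraction \<open>A n\<close>.\<close>
          have "A m (y m ?z) ?z - A n (y n ?z) ?z =
              (\<Sum>\<beta>\<in>Basis. (y m ?z \<bullet> \<beta>) *\<^sub>R (a \<beta> m ?z - a \<beta> n ?z)) + A n (y m ?z - y n ?z) ?z"
            by (simp add: A_def inner_diff_left scaleR_diff_left scaleR_diff_right sum_subtractf)
          also have "norm \<dots> \<le> (\<Sum>\<beta>\<in>(Basis::'a set). B * e') + D/2"
          proof (rule norm_triangle_le[OF add_mono])
            show "norm (\<Sum>\<beta>\<in>Basis. (y m ?z \<bullet> \<beta>) *\<^sub>R (a \<beta> m ?z - a \<beta> n ?z)) \<le> (\<Sum>\<beta>\<in>(Basis::'a set). B * e')"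
            proof (rule sum_norm_le)
              fix \<beta> :: 'a assume \<beta>: "\<beta> \<in> Basis"
              have "\<bar>y m ?z \<bullet> \<beta>\<bar> \<le> B"
                using Basis_le_norm[OF \<beta>, of "y m ?z"] yB[OF tz, of m] by linarith
              then show "norm ((y m ?z \<bullet> \<beta>) *\<^sub>R (a \<beta> m ?z - a \<beta> n ?z)) \<le> B * e'"
                using Nf[OF \<beta> _ _ tz, of m n] NfN[OF \<beta>] mn \<open>B \<ge> 0\<close>
                by (auto intro!: mult_mono)
            qed
            show "norm (A n (y m ?z - y n ?z) ?z) \<le> D/2"
              using small'[OF tz, of n "y m ?z - y n ?z"] bspec[OF D tz] by linarith
          qed
          finally show ?thesis using e'e by simp
        qed
        then have "norm (time_integral (\<lambda>z. A m (y m z) z - A n (y n z) z) z) \<le> e/2 + D/2"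
          by (intro time_integral_norm_le[OF _ z] continuous_on_diff cA)
        moreover have "norm (b m z - b n z) \<le> e/2"
          using mn z by (intro N1) (auto simp: N_def)
        moreover have "y (Suc m) z - y (Suc n) z =
            (b m z - b n z) + time_integral (\<lambda>z. A m (y m z) z - A n (y n z) z) z"
          unfolding rec'[OF z] time_integral_diff[OF cA cA z, symmetric] by simp
        ultimately show ?thesis
          using norm_triangle_ineq[of "b m z - b n z" "time_integral (\<lambda>z. A m (y m z) z - A n (y n z) z) z"]
          by simp
      qed
      then show "\<exists>N. \<forall>m\<ge>N. \<forall>n\<ge>N. \<forall>D. (\<forall>s\<in>?S. norm (y m s - y n s) \<le> D) \<longrightarrow>
          (\<forall>s\<in>?S. norm (y (Suc m) s - y (Suc n) s) \<le> e + D/2)"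
        by blast
    qed
  qed
  then show ?thesis using y by (auto simp: C0_seq_def)
qed

lemma Ck_seq_continuous_on: "Ck_seq k V x \<Longrightarrow> continuous_on ({0..1} \<times> V) (x n)"
  by (intro C0_seq_continuous_on Ck_seq_imp_C0_seq)

lemma Ck_seq_scaleR_inner:
  assumes "open V" "Ck_seq k V y" "Ck_seq k V a"
  shows "Ck_seq k V (\<lambda>n z. (y n z \<bullet> \<beta>) *\<^sub>R a n z)"
  by (intro Ck_seq_bilinear[OF bounded_bilinear_scaleR] Ck_seq_bilinear[OF bounded_bilinear_inner]
      Ck_seq_const assms)

text \<open>Differentiating the recursion in space gives a recursion of the same shape for the derivative,
  with the same coefficients \<open>a\<close>, so convergence of derivatives of every order reduces to
  \<open>C0_seq_recursion\<close>.\<close>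

lemma Ck_seq_recursion:
  fixes y :: "nat \<Rightarrow> real \<times> 'p::euclidean_space \<Rightarrow> 'a::euclidean_space"
  assumes V: "open V"
    and small: "\<And>n z w. z \<in> {0..1} \<times> V \<Longrightarrow> norm (\<Sum>\<beta>\<in>Basis. (w \<bullet> \<beta>) *\<^sub>R a \<beta> n z) \<le> norm w / 2"
  shows "(\<And>n. Ck_seq k V (\<lambda>_. y n)) \<Longrightarrow> Ck_seq k V b \<Longrightarrow>
    (\<And>\<beta>. \<beta> \<in> Basis \<Longrightarrow> Ck_seq k V (a \<beta>)) \<Longrightarrow>
    (\<And>n z. z \<in> {0..1} \<times> V \<Longrightarrow>
      y (Suc n) z = b n z + time_integral (\<lambda>z. \<Sum>\<beta>\<in>Basis. (y n z \<bullet> \<beta>) *\<^sub>R a \<beta> n z) z) \<Longrightarrow>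
    Ck_seq k V y"
proof (induction k arbitrary: b y)
  case 0
  show ?case unfolding Ck_seq.simps
    by (rule C0_seq_recursion[where a = a and b = b])
       (use 0 small Ck_seq_continuous_on[OF 0(1)] in auto)
next
  case (Suc k)
  have y: "Ck_seq k V y"
    by (rule Suc.IH[OF Ck_seq_Suc_imp[OF Suc.prems(1)] Ck_seq_Suc_imp[OF Suc.prems(2)]
          Ck_seq_Suc_imp[OF Suc.prems(3)] Suc.prems(4)])
  note Dy = Ck_seq_space_deriv[OF Suc.prems(1)] and Db = Ck_seq_space_deriv[OF Suc.prems(2)]
    and Da = Ck_seq_space_deriv[OF Suc.prems(3)]
  \<comment> \<open>The product rule for the summands: \<open>?P\<close> contains \<open>y\<close>
    only undifferentiated, already known to converge to order \<open>k\<close>, and joins the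
    inhomogeneity; \<open>?Q\<close> is the old linear part acting on the derivative.\<close>
  let ?P = "\<lambda>n h z. \<Sum>\<beta>\<in>Basis. (y n z \<bullet> \<beta>) *\<^sub>R space_deriv (a \<beta> n) z h"
  let ?Q = "\<lambda>n h z. \<Sum>\<beta>\<in>Basis. (space_deriv (y n) z h \<bullet> \<beta>) *\<^sub>R a \<beta> n z"
  have cP: "continuous_on ({0..1} \<times> V) (?P n h)" for n h
    by (intro continuous_intros Ck_seq_continuous_on[OF y] Ck_seq_continuous_on[OF Da])
  have cQ: "continuous_on ({0..1} \<times> V) (?Q n h)" for n h
    by (intro continuous_intros Ck_seq_continuous_on[OF Dy] Ck_seq_continuous_on[OF Suc.prems(3)])
  have D: "((\<lambda>v. y (Suc n) (t, v)) has_derivative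
      (\<lambda>h. space_deriv (b n) (t, v) h + time_integral (\<lambda>z. ?P n h z + ?Q n h z) (t, v))) (at v)"
    if tv: "t \<in> {0..1}" "v \<in> V" for n t v
  proof -
    have "((\<lambda>v. time_integral (\<lambda>z. \<Sum>\<beta>\<in>Basis. (y n z \<bullet> \<beta>) *\<^sub>R a \<beta> n z) (t, v)) has_derivative
        (\<lambda>h. time_integral (\<lambda>z. ?P n h z + ?Q n h z) (t, v))) (at v)"
    proof (rule time_integral_has_derivative[OF V _ _ _ tv])
      show "continuous_on ({0..1} \<times> V) (\<lambda>z. \<Sum>\<beta>\<in>Basis. (y n z \<bullet> \<beta>) *\<^sub>R a \<beta> n z)"
        by (intro continuous_intros Ck_seq_continuous_on[OF y] Ck_seq_continuous_on[OF Suc.prems(3)])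
      show "continuous_on ({0..1} \<times> V) (\<lambda>z. ?P n h z + ?Q n h z)" for h
        by (intro continuous_on_add cP cQ)
      fix t v assume tv: "t \<in> {0..1::real}" "v \<in> V"
      show "((\<lambda>v. \<Sum>\<beta>\<in>Basis. (y n (t, v) \<bullet> \<beta>) *\<^sub>R a \<beta> n (t, v)) has_derivative
          (\<lambda>h. ?P n h (t, v) + ?Q n h (t, v))) (at v)"
        unfolding sum.distrib[symmetric]
        by (intro has_derivative_sum has_derivative_scaleR
            bounded_linear.has_derivative[OF bounded_linear_inner_left]
            Ck_seq_has_derivative[OF Suc.prems(1) tv] Ck_seq_has_derivative[OF Suc.prems(3) tv])
    qed
    then have "((\<lambda>v. b n (t, v) + time_integral (\<lambda>z. \<Sum>\<beta>\<in>Basis. (y n z \<bullet> \<beta>) *\<^sub>R a \<beta> n z) (t, v)) has_derivative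
        (\<lambda>h. space_deriv (b n) (t, v) h + time_integral (\<lambda>z. ?P n h z + ?Q n h z) (t, v))) (at v)"
      by (intro has_derivative_add Ck_seq_has_derivative[OF Suc.prems(2) tv])
    then show ?thesis
      by (rule has_derivative_transform_within_open[OF _ V tv(2)]) (use tv Suc.prems(4) in auto)
  qed
  have "Ck_seq k V (\<lambda>n z. space_deriv (y n) z h)" for h
  proof (rule Suc.IH[where b = "\<lambda>n z. space_deriv (b n) z h + time_integral (?P n h) z"])
    show "Ck_seq k V (\<lambda>_ z. space_deriv (y n) z h)" for n
      by (rule Dy)
    show "Ck_seq k V (\<lambda>n z. space_deriv (b n) z h + time_integral (?P n h) z)"
      by (intro Ck_seq_add Ck_seq_time_integral Ck_seq_sum Ck_seq_scaleR_inner V y Db Da)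
    show "Ck_seq k V (a \<beta>)" if "\<beta> \<in> Basis" for \<beta>
      by (rule Ck_seq_Suc_imp[OF Suc.prems(3)[OF that]])
    fix n z assume z: "z \<in> {0..1::real} \<times> V"
    then obtain t v where tv: "z = (t, v)" "t \<in> {0..1}" "v \<in> V" by auto
    show "space_deriv (y (Suc n)) z h =
        space_deriv (b n) z h + time_integral (?P n h) z + time_integral (?Q n h) z"
      using space_deriv_eqI[OF D[OF tv(2,3)]] time_integral_add[OF cP cQ z] by (simp add: tv(1) add.assoc)
  qed
  moreover have "(\<lambda>v. y n (t, v)) differentiable at v" if "t \<in> {0..1}" "v \<in> V" for n t v
    using Ck_seq_has_derivative[OF Suc.prems(1) that] by (rule differentiableI)
  ultimately show ?case
    using Ck_seq_imp_C0_seq[OF y] by auto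
qed

section \<open>Differentiability of limits\<close>

text \<open>Convergence to \<open>X\<close> is assumed pointwise; its local uniformity, at each
  order, is contained in \<open>Ck_seq\<close>. Each order is the classical theorem on limits of
  derivatives, applied to the sequence of directional derivatives of the previous order.\<close>

lemma Ck_seq_limit:
  assumes V: "open V" and t: "t \<in> {0..1}"
  shows "Ck_seq k V x \<Longrightarrow> (\<And>v. v \<in> V \<Longrightarrow> (\<lambda>n. x n (t, v)) \<longlonglongrightarrow> X v) \<Longrightarrow> Ck_on k V X"
proof (induction k arbitrary: x X)
  have unif: "uniform_limit C (\<lambda>n v. x n (t, v)) X sequentially"
    if x: "C0_seq V x" and lim: "\<And>v. v \<in> V \<Longrightarrow> (\<lambda>n. x n (t, v)) \<longlonglongrightarrow> X v"
      and C: "compact C" "C \<subseteq> V"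
    for x :: "nat \<Rightarrow> real \<times> 'a \<Rightarrow> 'b" and X C
  proof -
    obtain l where l: "uniform_limit ({0..1} \<times> C) x l sequentially"
      using x C unfolding C0_seq_def uniformly_convergent_on_def by blast
    have "uniform_limit C (\<lambda>n v. x n (t, v)) (\<lambda>v. l (t, v)) sequentially"
    proof (rule uniform_limitI)
      fix e :: real assume "e > 0"
      with l have "\<forall>\<^sub>F n in sequentially. \<forall>z\<in>{0..1} \<times> C. dist (x n z) (l z) < e"
        by (rule uniform_limitD)
      then show "\<forall>\<^sub>F n in sequentially. \<forall>v\<in>C. dist (x n (t, v)) (l (t, v)) < e"
        by eventually_elim (use t in auto)
    qed
    moreover have "l (t, v) = X v" if "v \<in> C" for v
      using tendsto_uniform_limitI[OF l, of "(t, v)"] that t C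
        LIMSEQ_unique lim by blast
    ultimately show ?thesis
      by (simp cong: uniform_limit_cong')
  qed
  {
    case 0
    have "isCont X v" if v: "v \<in> V" for v
    proof -
      obtain r where r: "r > 0" "cball v r \<subseteq> V"
        using V v open_contains_cball by blast
      have "continuous_on (cball v r) X"
      proof (rule uniform_limit_theorem)
        show "uniform_limit (cball v r) (\<lambda>n v. x n (t, v)) X sequentially"
          by (rule unif[OF Ck_seq_imp_C0_seq[OF 0(1)] 0(2)]) (use r in auto)
        have "continuous_on (cball v r) (\<lambda>v. x n (t, v))" for n
          by (rule continuous_on_compose2[OF Ck_seq_continuous_on[OF 0(1)]])
             (use t r in \<open>auto intro!: continuous_intros\<close>)
        then show "\<forall>\<^sub>F n in sequentially. continuous_on (cball v r) (\<lambda>v. x n (t, v))" by simp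
      qed simp
      then show ?thesis
        using r by (intro continuous_on_interior[of "cball v r"]) auto
    qed
    then show ?case by (simp add: continuous_at_imp_continuous_on)
  next
    case (Suc k)
    define Dl where "Dl b v = lim (\<lambda>n. space_deriv (x n) (t, v) b)" for b v
    have Dl: "(\<lambda>n. space_deriv (x n) (t, v) b) \<longlonglongrightarrow> Dl b v" if "v \<in> V" for v b
    proof -
      have "uniformly_convergent_on ({0..1} \<times> {v}) (\<lambda>n z. space_deriv (x n) z b)"
        using Ck_seq_imp_C0_seq[OF Ck_seq_space_deriv[OF Suc.prems(1)]] that unfolding C0_seq_def by auto
      from uniformly_convergent_imp_convergent[OF this, of "(t, v)"] t show ?thesis
        by (simp add: Dl_def convergent_LIMSEQ_iff)
    qed
    \<comment> \<open>Assembled from the limits along the basis: finitely many directions make the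
      convergence uniform over all \<open>h\<close>, relative to \<open>norm h\<close>.\<close>
    define D where "D v h = (\<Sum>b\<in>Basis. (h \<bullet> b) *\<^sub>R Dl b v)" for v h
    have lin: "space_deriv (x n) (t, v) h = (\<Sum>b\<in>Basis. (h \<bullet> b) *\<^sub>R space_deriv (x n) (t, v) b)"
      if "v \<in> V" for n v h
      using Ck_seq_has_derivative[OF Suc.prems(1) t that] has_derivative_linear
      by (intro linear_eq_sum_Basis) blast
    have XD: "(X has_derivative D v) (at v)" if v: "v \<in> V" for v
    proof -
      \<comment> \<open>Compactness of the closed ball gives uniform convergence; its convexity is
        what \<open>has_derivative_sequence\<close> asks for.\<close>
      obtain r where r: "r > 0" "cball v r \<subseteq> V"
        using V v open_contains_cball by blast
      have "\<exists>g. \<forall>w\<in>cball v r. (\<lambda>n. x n (t, w)) \<longlonglongrightarrow> g w \<and> (g has_derivative D w) (at w within cball v r)"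
      proof (rule has_derivative_sequence)
        show "((\<lambda>v. x n (t, v)) has_derivative space_deriv (x n) (t, w)) (at w within cball v r)"
          if "w \<in> cball v r" for n w
          by (rule has_derivative_at_withinI, rule Ck_seq_has_derivative[OF Suc.prems(1) t]) (use that r in auto)
        show "(\<lambda>n. x n (t, v)) \<longlonglongrightarrow> X v" using Suc.prems(2)[OF v] .
        fix e :: real assume e: "e > 0"
        \<comment> \<open>Each basis direction contributes at most \<open>norm h * d\<close>, hence
          the division by the dimension.\<close>
        define d where "d = e / DIM('a)"
        have d: "d > 0" using e by (simp add: d_def)
        have "\<forall>b\<in>Basis. \<forall>\<^sub>F n in sequentially. \<forall>w\<in>cball v r. dist (space_deriv (x n) (t, w) b) (Dl b w) < d"
        proof
          fix b :: 'a
          have "uniform_limit (cball v r) (\<lambda>n w. space_deriv (x n) (t, w) b) (Dl b) sequentially"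
            by (rule unif[where x = "\<lambda>n z. space_deriv (x n) z b"])
              (use Dl r Ck_seq_imp_C0_seq[OF Ck_seq_space_deriv[OF Suc.prems(1)]] in auto)
          then show "\<forall>\<^sub>F n in sequentially. \<forall>w\<in>cball v r. dist (space_deriv (x n) (t, w) b) (Dl b w) < d"
            using d by (rule uniform_limitD)
        qed
        then have "\<forall>\<^sub>F n in sequentially. \<forall>b\<in>Basis. \<forall>w\<in>cball v r. dist (space_deriv (x n) (t, w) b) (Dl b w) < d"
          by (simp add: eventually_ball_finite)
        then show "\<forall>\<^sub>F n in sequentially. \<forall>w\<in>cball v r. \<forall>h. norm (space_deriv (x n) (t, w) h - D w h) \<le> e * norm h"
        proof (eventually_elim, safe)
          fix n w h
          assume *: "\<forall>b\<in>Basis. \<forall>w\<in>cball v r. dist (space_deriv (x n) (t, w) b) (Dl b w) < d"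
            and w: "w \<in> cball v r"
          have "space_deriv (x n) (t, w) h - D w h =
              (\<Sum>b\<in>Basis. (h \<bullet> b) *\<^sub>R (space_deriv (x n) (t, w) b - Dl b w))"
            using w r by (subst lin) (auto simp: D_def scaleR_diff_right sum_subtractf)
          also have "norm \<dots> \<le> (\<Sum>b\<in>(Basis::'a set). norm h * d)"
          proof (rule sum_norm_le)
            fix b :: 'a assume b: "b \<in> Basis"
            have "norm (space_deriv (x n) (t, w) b - Dl b w) \<le> d"
              using * w b unfolding dist_norm by (meson less_imp_le)
            then show "norm ((h \<bullet> b) *\<^sub>R (space_deriv (x n) (t, w) b - Dl b w)) \<le> norm h * d"
              using Basis_le_norm[OF b, of h] by (simp add: mult_mono)
          qed
          also have "\<dots> = e * norm h" by (simp add: d_def)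
          finally show "norm (space_deriv (x n) (t, w) h - D w h) \<le> e * norm h" .
        qed
      qed (use r in auto)
      then obtain g where g: "\<And>w. w \<in> cball v r \<Longrightarrow> (\<lambda>n. x n (t, w)) \<longlonglongrightarrow> g w"
          "\<And>w. w \<in> cball v r \<Longrightarrow> (g has_derivative D w) (at w within cball v r)"
        by blast
      have "(g has_derivative D v) (at v within ball v r)"
        by (rule has_derivative_subset[OF g(2)]) (use r in auto)
      then have "(g has_derivative D v) (at v)"
        using r at_within_open[of v "ball v r"] by simp
      \<comment> \<open>\<open>has_derivative_sequence\<close> supplies just some limit
        \<open>g\<close>; uniqueness of limits identifies it with \<open>X\<close>.\<close>
      moreover have "g w = X w" if "w \<in> ball v r" for w
      proof -
        have "w \<in> cball v r" "w \<in> V" using r that by auto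
        then show ?thesis using LIMSEQ_unique[OF g(1) Suc.prems(2)] by blast
      qed
      ultimately show ?thesis
        using r by (elim has_derivative_transform_within_open[where s = "ball v r"]) auto
    qed
    have "Ck_on k V (\<lambda>v. frechet_derivative X (at v) h)" for h
    proof (rule Suc.IH[OF Ck_seq_space_deriv[OF Suc.prems(1)]])
      fix v assume v: "v \<in> V"
      show "(\<lambda>n. space_deriv (x n) (t, v) h) \<longlonglongrightarrow> frechet_derivative X (at v) h"
        unfolding frechet_derivative_at[OF XD[OF v], symmetric] lin[OF v, of _ h] D_def
        by (intro tendsto_intros Dl v)
    qed
    then show ?case
      using XD by (auto intro: differentiableI)
  }
qed

section \<open>Smooth local flows\<close>

lemma Ck_on_cong:
  fixes f :: "'a::euclidean_space \<Rightarrow> 'b::euclidean_space"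
  assumes "open V" "Ck_on k V f" "\<And>x. x \<in> V \<Longrightarrow> f x = g x"
  shows "Ck_on k V g"
  using Ck_seq_cong[OF assms(1), of "\<lambda>n z. f (snd z)" "\<lambda>n z. g (snd z)" k] assms
  by (auto simp: Ck_seq_snd_iff)

lemma Ck_on_const: "open V \<Longrightarrow> Ck_on k V (\<lambda>x::'a::euclidean_space. c::'b::euclidean_space)"
  using Ck_seq_const[of V k c] by (simp flip: Ck_seq_snd_iff)

lemma Ck_on_bilinear:
  fixes f :: "'a::euclidean_space \<Rightarrow> 'b::euclidean_space" and g :: "'a \<Rightarrow> 'c::euclidean_space"
    and pr :: "'b \<Rightarrow> 'c \<Rightarrow> 'd::euclidean_space"
  assumes "bounded_bilinear pr" "open V" "Ck_on k V f" "Ck_on k V g"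
  shows "Ck_on k V (\<lambda>x. pr (f x) (g x))"
  using Ck_seq_bilinear[OF assms(1,2), of k "\<lambda>n z. f (snd z)" "\<lambda>n z. g (snd z)"] assms
  by (simp add: Ck_seq_snd_iff Ck_seq_snd_iff[of V k "\<lambda>x. pr (f x) (g x)"])

lemma Ck_on_add:
  fixes f :: "'a::euclidean_space \<Rightarrow> 'b::euclidean_space"
  assumes "open V" "Ck_on k V f" "Ck_on k V g"
  shows "Ck_on k V (\<lambda>x. f x + g x)"
  using Ck_seq_add[OF assms(1), of k "\<lambda>n z. f (snd z)" "\<lambda>n z. g (snd z)"] assms
  by (simp add: Ck_seq_snd_iff Ck_seq_snd_iff[of V k "\<lambda>x. f x + g x"])

lemma Ck_on_sum:
  fixes f :: "'i \<Rightarrow> 'a::euclidean_space \<Rightarrow> 'b::euclidean_space"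
  assumes "open V" "\<And>i. i \<in> I \<Longrightarrow> Ck_on k V (f i)"
  shows "Ck_on k V (\<lambda>x. \<Sum>i\<in>I. f i x)"
  using assms(2)
  by (induction I rule: infinite_finite_induct) (auto intro: Ck_on_const Ck_on_add assms(1))

lemma Ck_on_linear:
  assumes "bounded_linear (f :: 'a::euclidean_space \<Rightarrow> 'b::euclidean_space)" "open V"
  shows "Ck_on k V f"
proof (cases k)
  case (Suc j)
  have D: "(f has_derivative f) (at x)" for x
    by (rule bounded_linear_imp_has_derivative[OF assms(1)])
  show ?thesis
    unfolding Suc using D
    by (auto simp: Ck_on_const[OF assms(2)] simp flip: frechet_derivative_at[OF D] intro: differentiableI)
qed (auto intro: linear_continuous_on[OF assms(1)])

lemma Ck_on_compose:
  fixes f :: "'b::euclidean_space \<Rightarrow> 'c::euclidean_space" and g :: "'a::euclidean_space \<Rightarrow> 'b"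
  assumes "open V" "Ck_on k U f" "Ck_on k V g" "g ` V \<subseteq> U"
  shows "Ck_on k V (\<lambda>x. f (g x))"
proof -
  have "Ck_seq k V (\<lambda>n z. f (g (snd z)))"
  proof (rule Ck_seq_compose[OF assms(1,2)])
    show "Ck_seq k V (\<lambda>n z. g (snd z))"
      using assms by (simp add: Ck_seq_snd_iff)
    fix C assume "compact C" "C \<subseteq> V"
    then have "compact (g ` C)" "g ` C \<subseteq> U"
      using assms Ck_on_imp_continuous_on continuous_on_subset
      by (blast intro: compact_continuous_image)+
    then show "\<exists>K. compact K \<and> K \<subseteq> U \<and> (\<forall>n. (\<lambda>z. g (snd z)) ` ({0..1::real} \<times> C) \<subseteq> K)"
      by (intro exI[of _ "g ` C"]) auto
  qed
  then show ?thesis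
    using Ck_seq_snd_iff[OF assms(1), of k "\<lambda>x. f (g x)"] by simp
qed

section \<open>Picard iteration and local flows\<close>

lemma time_integral_eq_integral:
  assumes "t \<in> {0..1}"
  shows "time_integral g (t, p) = integral {0..t} (\<lambda>s. g (s, p))"
proof (cases "t = 0")
  case False
  then have t: "t > 0" using assms by simp
  have "(\<lambda>x. x / t) ` {0..t} = {0..1}"
    using t by (simp add: image_divide_atLeastAtMost)
  with integral_stretch_real[of t 0 t "\<lambda>s. g (s, p)"] t show ?thesis
    by (simp add: time_integral_def)
qed (simp add: time_integral_def)

primrec picard :: "('a::euclidean_space \<Rightarrow> 'a) \<Rightarrow> nat \<Rightarrow> real \<times> 'a \<Rightarrow> 'a" where
  "picard f 0 = snd"
| "picard f (Suc n) = (\<lambda>z. snd z + time_integral (\<lambda>z. f (picard f n z)) z)"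

text \<open>Speed at most \<open>r\<close> keeps the iterates started in \<open>V\<close> inside
  \<open>K\<close> up to time 1, and a derivative of norm at most 1/2 on the convex set
  \<open>K\<close> makes the Picard step a contraction; the same 1/2 governs the variational
  equation. All orders of smoothness thus hold on the whole of \<open>V\<close>.\<close>

lemma picard_flow:
  fixes f :: "'a::euclidean_space \<Rightarrow> 'a"
  assumes f: "\<And>k. Ck_on k U f" and V: "open V" and K: "compact K" "convex K" "K \<subseteq> U"
    and VK: "\<And>p. p \<in> V \<Longrightarrow> cball p r \<subseteq> K" and "r \<ge> 0"
    and fr: "\<And>x. x \<in> K \<Longrightarrow> norm (f x) \<le> r"
    and Df: "\<And>x w. x \<in> K \<Longrightarrow> norm (frechet_derivative f (at x) w) \<le> norm w / 2"
  obtains X where "\<And>p. p \<in> V \<Longrightarrow> X (0, p) = p"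
    "\<And>t p. t \<in> {0..1} \<Longrightarrow> p \<in> V \<Longrightarrow> X (t, p) \<in> K"
    "\<And>t p. t \<in> {0..1} \<Longrightarrow> p \<in> V \<Longrightarrow>
      ((\<lambda>t. X (t, p)) has_vector_derivative f (X (t, p))) (at t within {0..1})"
    "\<And>k. Ck_on k V (\<lambda>p. X (1, p))"
proof -
  let ?x = "picard f"
  have compK: "\<exists>K'. compact K' \<and> K' \<subseteq> U \<and> (\<forall>n. y n ` ({0..1} \<times> C) \<subseteq> K')"
    if "\<And>n z. z \<in> {0..1} \<times> V \<Longrightarrow> y n z \<in> K" "C \<subseteq> V" for y :: "nat \<Rightarrow> real \<times> 'a \<Rightarrow> 'a" and C
    using that K by (intro exI[of _ K]) blast
  \<comment> \<open>Regularity of each single iterate, as a constant sequence: it says nothing about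
    convergence, but the recursion for the derivatives presupposes it.\<close>
  have reg: "(\<forall>k. Ck_seq k V (\<lambda>_. ?x n)) \<and> (\<forall>z\<in>{0..1} \<times> V. ?x n z \<in> K)" for n
  proof (induction n)
    case 0
    have "p \<in> K" if "p \<in> V" for p using VK[OF that] \<open>r \<ge> 0\<close> by auto
    then show ?case using Ck_seq_snd[OF V] by auto
  next
    case (Suc n)
    have C: "Ck_seq k V (\<lambda>_ z. f (?x n z))" for k
    proof (rule Ck_seq_compose[OF V f[of k]])
      show "\<exists>K'. compact K' \<and> K' \<subseteq> U \<and> (\<forall>m::nat. ?x n ` ({0..1} \<times> C) \<subseteq> K')"
        if "C \<subseteq> V" for C
        by (rule compK[of "\<lambda>_. ?x n"]) (use Suc that in auto)
    qed (use Suc in auto)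
    then have C': "Ck_seq k V (\<lambda>_. ?x (Suc n))" for k
      unfolding picard.simps by (intro Ck_seq_add Ck_seq_snd Ck_seq_time_integral V)
    have "?x (Suc n) z \<in> K" if "z \<in> {0..1} \<times> V" for z
    proof -
      have "norm (time_integral (\<lambda>z. f (?x n z)) z) \<le> r"
        by (rule time_integral_norm_le[OF Ck_seq_continuous_on[OF C[of 0]] that])
           (use Suc that fr in auto)
      then have "?x (Suc n) z \<in> cball (snd z) r" by (simp add: dist_norm)
      moreover have "snd z \<in> V" using that by auto
      ultimately show ?thesis using VK by blast
    qed
    then show ?case using C' by blast
  qed
  have xK: "?x n z \<in> K" if "z \<in> {0..1} \<times> V" for n z using reg that by blast
  have cx: "continuous_on ({0..1} \<times> V) (?x n)" for n
    using reg Ck_seq_continuous_on by blast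
  have cfx: "continuous_on ({0..1} \<times> V) (\<lambda>z. f (?x n z))" for n
    by (rule continuous_on_compose2[OF Ck_on_imp_continuous_on[OF f[of 0]] cx]) (use xK K in auto)
  have lip: "norm (f a - f b) \<le> norm (a - b) / 2" if "a \<in> K" "b \<in> K" for a b
  proof -
    have "norm (f a - f b) \<le> (1/2) * norm (a - b)"
    proof (rule differentiable_bound[OF K(2) _ _ that])
      show "(f has_derivative frechet_derivative f (at x)) (at x within K)" if "x \<in> K" for x
        by (rule has_derivative_at_withinI[OF Ck_on_has_derivative[OF f]]) (use that K in auto)
      show "onorm (frechet_derivative f (at x)) \<le> 1/2" if "x \<in> K" for x
        by (rule onorm_le) (use Df[OF that] in auto)
    qed
    then show ?thesis by simp
  qed
  have "uniformly_convergent_on ({0..1} \<times> C) ?x" if C: "compact C" "C \<subseteq> V" for C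
  proof -
    obtain B where B: "\<And>x. x \<in> K \<Longrightarrow> norm x \<le> B"
      using compact_imp_bounded[OF K(1)] unfolding bounded_iff by blast
    show ?thesis
    proof (rule uniformly_convergent_on_half_contraction)
      show "norm (?x n z) \<le> B" if "z \<in> {0..1} \<times> C" for n z
        using that C by (intro B xK) auto
      fix e :: real assume "e > 0"
      have "norm (?x (Suc m) z - ?x (Suc n) z) \<le> e + D/2"
        if D: "\<forall>z\<in>{0..1} \<times> C. norm (?x m z - ?x n z) \<le> D" and z: "z \<in> {0..1} \<times> C" for m n D z
      proof -
        have zV: "z \<in> {0..1} \<times> V" using z C by auto
        have "norm (f (?x m (t, snd z)) - f (?x n (t, snd z))) \<le> D/2" if "t \<in> {0..1}" for t
          using lip[OF xK xK, of "(t, snd z)" "(t, snd z)" m n] D[rule_format, of "(t, snd z)"] that z zV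
          by auto
        then have "norm (time_integral (\<lambda>z. f (?x m z) - f (?x n z)) z) \<le> D/2"
          by (intro time_integral_norm_le[OF _ zV] continuous_on_diff cfx)
        then show ?thesis
          using time_integral_diff[OF cfx cfx zV, of m n] \<open>e > 0\<close> by simp
      qed
      then show "\<exists>N. \<forall>m\<ge>N. \<forall>n\<ge>N. \<forall>D. (\<forall>s\<in>{0..1} \<times> C. norm (?x m s - ?x n s) \<le> D) \<longrightarrow>
          (\<forall>s\<in>{0..1} \<times> C. norm (?x (Suc m) s - ?x (Suc n) s) \<le> e + D/2)"
        by blast
    qed
  qed
  then have C0: "C0_seq V ?x" using cx by (auto simp: C0_seq_def)
  \<comment> \<open>Order \<open>Suc k\<close> of the iterates needs the coefficients Df(x_n) to
    order \<open>k\<close>, and these follow from order \<open>k\<close> of the iterates by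
    composition.\<close>
  have Ck: "Ck_seq k V ?x" for k
  proof (induction k)
    case (Suc k)
    note reg' = reg[THEN conjunct1, rule_format]
    define a where "a \<beta> n z = frechet_derivative f (at (?x n z)) \<beta>" for \<beta> n z
    have Df_eq: "frechet_derivative f (at (?x n z)) w = (\<Sum>\<beta>\<in>Basis. (w \<bullet> \<beta>) *\<^sub>R a \<beta> n z)"
      if "z \<in> {0..1} \<times> V" for n z w
      unfolding a_def
      by (rule linear_eq_sum_Basis, rule has_derivative_linear, rule Ck_on_has_derivative[OF f])
         (use xK that K in auto)
    have a: "Ck_seq k V (a \<beta>)" for \<beta>
      unfolding a_def
      by (rule Ck_seq_compose[OF V _ Suc]) (use f[of "Suc k"] compK xK in auto)
    have "Ck_seq k V (\<lambda>n z. space_deriv (?x n) z h)" for h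
    \<comment> \<open>Differentiating the Picard step in the initial value gives the iteration for
      the variational equation; its inhomogeneity is the constant \<open>h\<close>, the derivative
      of the initial value.\<close>
    proof (rule Ck_seq_recursion[OF V, where a = a and b = "\<lambda>_ _. h"])
      show "norm (\<Sum>\<beta>\<in>Basis. (w \<bullet> \<beta>) *\<^sub>R a \<beta> n z) \<le> norm w / 2" if "z \<in> {0..1} \<times> V" for n z w
        using Df[OF xK[OF that]] by (simp flip: Df_eq[OF that])
      show "Ck_seq k V (\<lambda>_ z. space_deriv (?x n) z h)" for n
        by (rule Ck_seq_space_deriv[OF reg'])
      fix n and z :: "real \<times> 'a" assume z: "z \<in> {0..1} \<times> V"
      then obtain t v where tv: "z = (t, v)" "t \<in> {0..1}" "v \<in> V" by auto
      have "((\<lambda>v. ?x (Suc n) (t, v)) has_derivative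
        (\<lambda>h. h + time_integral (\<lambda>z. \<Sum>\<beta>\<in>Basis. (space_deriv (?x n) z h \<bullet> \<beta>) *\<^sub>R a \<beta> n z) (t, v))) (at v)"
        unfolding picard.simps snd_conv
      proof (intro has_derivative_add has_derivative_ident time_integral_has_derivative[OF V cfx _ _ tv(2,3)])
        show "continuous_on ({0..1} \<times> V) (\<lambda>z. \<Sum>\<beta>\<in>Basis. (space_deriv (?x n) z h \<bullet> \<beta>) *\<^sub>R a \<beta> n z)" for h
          by (intro continuous_intros Ck_seq_continuous_on[OF a]
              Ck_seq_continuous_on[OF Ck_seq_space_deriv[OF reg']])
        fix t v assume tv: "t \<in> {0..1::real}" "v \<in> V"
        have "((\<lambda>v. f (?x n (t, v))) has_derivative
            (\<lambda>h. frechet_derivative f (at (?x n (t, v))) (space_deriv (?x n) (t, v) h))) (at v)"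
          by (rule has_derivative_compose[OF Ck_seq_has_derivative[OF reg' tv] Ck_on_has_derivative[OF f]])
             (use xK tv K in auto)
        then show "((\<lambda>v. f (?x n (t, v))) has_derivative
            (\<lambda>h. \<Sum>\<beta>\<in>Basis. (space_deriv (?x n) (t, v) h \<bullet> \<beta>) *\<^sub>R a \<beta> n (t, v))) (at v)"
          using tv by (simp add: Df_eq)
      qed
      from space_deriv_eqI[OF this] show "space_deriv (?x (Suc n)) z h =
          h + time_integral (\<lambda>z. \<Sum>\<beta>\<in>Basis. (space_deriv (?x n) z h \<bullet> \<beta>) *\<^sub>R a \<beta> n z) z"
        by (simp add: tv(1))
    qed (use V a in \<open>auto intro: Ck_seq_const\<close>)
    moreover have "(\<lambda>v. ?x n (t, v)) differentiable at v" if "t \<in> {0..1}" "v \<in> V" for n t v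
      using Ck_seq_has_derivative[OF reg' that] by (rule differentiableI)
    ultimately show ?case using C0 by auto
  qed (simp add: C0)
  define X where "X z = lim (\<lambda>n. ?x n z)" for z
  have unif: "uniform_limit ({0..1} \<times> C) ?x X sequentially" if "compact C" "C \<subseteq> V" for C
    using C0 that unfolding C0_seq_def X_def by (auto simp: uniformly_convergent_uniform_limit_iff)
  have lim: "(\<lambda>n. ?x n z) \<longlonglongrightarrow> X z" if "z \<in> {0..1} \<times> V" for z
    by (rule tendsto_uniform_limitI[OF unif[of "{snd z}"]]) (use that in auto)
  have XK: "X z \<in> K" if "z \<in> {0..1} \<times> V" for z
    by (rule closed_sequentially[OF compact_imp_closed[OF K(1)] _ lim[OF that]]) (use xK that in auto)
  \<comment> \<open>The Picard step in the limit; uniform convergence over the single point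
    \<open>snd z\<close> is enough to exchange limit and time integral.\<close>
  have eq: "X z = snd z + time_integral (\<lambda>z. f (X z)) z" if z: "z \<in> {0..1} \<times> V" for z
  proof (rule LIMSEQ_unique)
    show "(\<lambda>n. ?x (Suc n) z) \<longlonglongrightarrow> X z"
      using lim[OF z] by (rule LIMSEQ_Suc)
    let ?S = "{0..1::real} \<times> {snd z}"
    have "uniform_limit ?S (\<lambda>n z. f (?x n z)) (\<lambda>z. f (X z)) sequentially"
    proof (rule uniform_limit_compose_uniformly_continuous_on[where f = f and B = K])
      show "uniform_limit ?S ?x X sequentially" by (rule unif) (use z in auto)
      show "uniformly_continuous_on K f"
        using K continuous_on_subset[OF Ck_on_imp_continuous_on[OF f[of 0]]]
        by (intro compact_uniformly_continuous) auto
      show "\<forall>\<^sub>F n in sequentially. \<forall>y\<in>?S. ?x n y \<in> K"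
        using z xK by (intro always_eventually) auto
      show "closed K" using K compact_imp_closed by blast
    qed
    then have "uniform_limit ?S (\<lambda>n. time_integral (\<lambda>z. f (?x n z))) (time_integral (\<lambda>z. f (X z))) sequentially"
      by (rule uniform_limit_time_integral) (use z in \<open>auto intro: continuous_on_subset[OF cfx]\<close>)
    then have "(\<lambda>n. time_integral (\<lambda>z. f (?x n z)) z) \<longlonglongrightarrow> time_integral (\<lambda>z. f (X z)) z"
      by (rule tendsto_uniform_limitI) (use z in auto)
    then show "(\<lambda>n. ?x (Suc n) z) \<longlonglongrightarrow> snd z + time_integral (\<lambda>z. f (X z)) z"
      by (auto intro: tendsto_intros)
  qed
  show ?thesis
  proof (rule that)
    show "X (0, p) = p" if "p \<in> V" for p
      using eq[of "(0, p)"] that by (simp add: time_integral_def)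
    show "X (t, p) \<in> K" if "t \<in> {0..1}" "p \<in> V" for t p
      using XK that by auto
    show "Ck_on k V (\<lambda>p. X (1, p))" for k
      by (rule Ck_seq_limit[OF V _ Ck, of 1]) (use lim in auto)
    fix t p assume tp: "t \<in> {0..1::real}" "p \<in> V"
    have "continuous_on ({0..1} \<times> {p}) X"
      by (rule uniform_limit_theorem[OF _ unif[of "{p}"]])
         (use tp in \<open>auto intro!: always_eventually continuous_on_subset[OF cx]\<close>)
    then have cX: "continuous_on {0..1} (\<lambda>t. X (t, p))"
      by (rule continuous_on_compose2) (auto intro!: continuous_intros)
    have "continuous_on {0..1} (\<lambda>t. f (X (t, p)))"
      by (rule continuous_on_compose2[OF Ck_on_imp_continuous_on[OF f[of 0]] cX]) (use XK tp K in auto)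
    from integral_has_vector_derivative[OF this tp(1)]
    have "((\<lambda>t. p + integral {0..t} (\<lambda>s. f (X (s, p)))) has_vector_derivative f (X (t, p))) (at t within {0..1})"
      by (auto intro!: derivative_eq_intros)
    then show "((\<lambda>t. X (t, p)) has_vector_derivative f (X (t, p))) (at t within {0..1})"
      by (rule has_vector_derivative_transform[OF tp(1), rotated])
         (use eq tp in \<open>auto simp: time_integral_eq_integral\<close>)
  qed
qed

text \<open>The factor \<open>\<epsilon>\<close> shrinks the vector field enough for its solutions to exist up to time 1.\<close>

lemma local_flow:
  fixes f :: "'a::euclidean_space \<Rightarrow> 'a"
  assumes U: "open U" "p0 \<in> U" and f: "smooth_on U f"
  obtains \<epsilon> r X where "\<epsilon> > 0" "r > 0"
    "\<And>p. p \<in> ball p0 r \<Longrightarrow> X (0, p) = p"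
    "\<And>t p. t \<in> {0..1} \<Longrightarrow> p \<in> ball p0 r \<Longrightarrow> X (t, p) \<in> U"
    "\<And>t p. t \<in> {0..1} \<Longrightarrow> p \<in> ball p0 r \<Longrightarrow>
      ((\<lambda>t. X (t, p)) has_vector_derivative \<epsilon> *\<^sub>R f (X (t, p))) (at t within {0..1})"
    "\<And>k. Ck_on k (ball p0 r) (\<lambda>p. X (1, p))"
proof -
  have f': "Ck_on k U f" for k using f by (simp add: smooth_on_def)
  obtain R where R: "R > 0" "cball p0 R \<subseteq> U"
    using U open_contains_cball by blast
  \<comment> \<open>Half of the radius for the starting points, half for the distance that solutions
    can travel up to time 1.\<close>
  define r where "r = R/2"
  have r: "r > 0" "R = 2 * r" using R by (auto simp: r_def)
  let ?K = "cball p0 R"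
  have bnd: "\<exists>B\<ge>0. \<forall>x\<in>?K. norm (g x) \<le> B" if "continuous_on U g" for g :: "'a \<Rightarrow> 'a"
  proof -
    have "bounded (g ` ?K)"
      by (intro compact_imp_bounded compact_continuous_image continuous_on_subset[OF that]) (use R in auto)
    then obtain B where "\<forall>x\<in>?K. norm (g x) \<le> B" unfolding bounded_iff by blast
    then show ?thesis by (intro exI[of _ "max 0 B"]) (auto intro: max.coboundedI2)
  qed
  obtain M where M: "M \<ge> 0" "\<And>x. x \<in> ?K \<Longrightarrow> norm (f x) \<le> M"
    using bnd[OF Ck_on_imp_continuous_on[OF f'[of 0]]] by blast
  have "\<forall>b\<in>Basis. \<exists>B\<ge>0. \<forall>x\<in>?K. norm (frechet_derivative f (at x) b) \<le> B"
    using f'[of "Suc 0"] by (intro ballI bnd) simp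
  then obtain B where B: "\<And>b. b \<in> Basis \<Longrightarrow> B b \<ge> 0"
      "\<And>b x. b \<in> Basis \<Longrightarrow> x \<in> ?K \<Longrightarrow> norm (frechet_derivative f (at x) b) \<le> B b"
    by metis
  define L where "L = (\<Sum>b\<in>Basis. B b)"
  have "L \<ge> 0" unfolding L_def using B by (intro sum_nonneg)
  have L: "norm (frechet_derivative f (at x) w) \<le> norm w * L" if x: "x \<in> ?K" for x w
  proof -
    have "linear (frechet_derivative f (at x))"
      using Ck_on_has_derivative[OF f', of x] has_derivative_linear x R by blast
    then have "frechet_derivative f (at x) w = (\<Sum>b\<in>Basis. (w \<bullet> b) *\<^sub>R frechet_derivative f (at x) b)"
      by (rule linear_eq_sum_Basis)
    also have "norm \<dots> \<le> (\<Sum>b\<in>Basis. norm w * B b)"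
    proof (rule sum_norm_le)
      fix b :: 'a assume b: "b \<in> Basis"
      show "norm ((w \<bullet> b) *\<^sub>R frechet_derivative f (at x) b) \<le> norm w * B b"
        using Basis_le_norm[OF b, of w] B(2)[OF b x] by (simp add: mult_mono)
    qed
    finally show ?thesis by (simp add: L_def sum_distrib_left)
  qed
  \<comment> \<open>The first entry brings the speed below \<open>r\<close>, the second the
    derivative below 1/2; adding 1 avoids a division by zero.\<close>
  define \<epsilon> where "\<epsilon> = min (r / (M + 1)) (1 / (2 * (L + 1)))"
  have \<epsilon>: "\<epsilon> > 0" using r M \<open>L \<ge> 0\<close> by (simp add: \<epsilon>_def)
  have "\<epsilon> * M \<le> r / (M + 1) * (M + 1)"
    using r M by (intro mult_mono) (auto simp: \<epsilon>_def)
  then have \<epsilon>M: "\<epsilon> * M \<le> r" using M by simp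
  have "\<epsilon> * L \<le> 1 / (2 * (L + 1)) * (L + 1)"
    using \<open>L \<ge> 0\<close> by (intro mult_mono) (auto simp: \<epsilon>_def)
  also have "\<dots> = 1/2" using \<open>L \<ge> 0\<close> by simp
  finally have \<epsilon>L: "\<epsilon> * L \<le> 1/2" .
  have D: "((\<lambda>x. \<epsilon> *\<^sub>R f x) has_derivative (\<lambda>w. \<epsilon> *\<^sub>R frechet_derivative f (at x) w)) (at x)"
    if "x \<in> ?K" for x
    by (rule has_derivative_scaleR_right[OF Ck_on_has_derivative[OF f']]) (use that R in auto)
  obtain X where X: "\<And>p. p \<in> ball p0 r \<Longrightarrow> X (0, p) = p"
    "\<And>t p. t \<in> {0..1} \<Longrightarrow> p \<in> ball p0 r \<Longrightarrow> X (t, p) \<in> ?K"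
    "\<And>t p. t \<in> {0..1} \<Longrightarrow> p \<in> ball p0 r \<Longrightarrow>
      ((\<lambda>t. X (t, p)) has_vector_derivative \<epsilon> *\<^sub>R f (X (t, p))) (at t within {0..1})"
    "\<And>k. Ck_on k (ball p0 r) (\<lambda>p. X (1, p))"
  proof (rule picard_flow[of U "\<lambda>x. \<epsilon> *\<^sub>R f x" "ball p0 r" ?K r])
    show "Ck_on k U (\<lambda>x. \<epsilon> *\<^sub>R f x)" for k
      by (rule Ck_on_bilinear[OF bounded_bilinear_scaleR U(1) Ck_on_const[OF U(1)] f'])
    show "cball p r \<subseteq> ?K" if "p \<in> ball p0 r" for p
      using that r by (auto simp: cball_subset_cball_iff dist_commute)
    show "norm (\<epsilon> *\<^sub>R f x) \<le> r" if "x \<in> ?K" for x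
      using order_trans[OF mult_left_mono[OF M(2)[OF that]] \<epsilon>M] \<epsilon> by simp
    show "norm (frechet_derivative (\<lambda>x. \<epsilon> *\<^sub>R f x) (at x) w) \<le> norm w / 2" if "x \<in> ?K" for x w
    proof -
      have "\<epsilon> * norm (frechet_derivative f (at x) w) \<le> \<epsilon> * (norm w * L)"
        using \<epsilon> by (intro mult_left_mono L that) simp
      also have "\<dots> \<le> norm w / 2"
        using mult_left_mono[OF \<epsilon>L, of "norm w"] by (simp add: mult_ac)
      finally show ?thesis using \<epsilon> by (simp flip: frechet_derivative_at[OF D[OF that]])
    qed
  qed (use r R in auto)
  show ?thesis
    by (rule that[OF \<epsilon> r(1) X(1) _ X(3,4)]) (use X(2) R in blast)+
qed

text \<open>The squared distance of the solutions, weighted by \<open>exp (- (2 * L * t))\<close>,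
  starts at 0 and is differentiable even where they meet. Solutions need not stay near their
  starting point, so \<open>L\<close> is taken on the compact union of the two trajectories.\<close>

lemma ode_solution_unique:
  fixes f :: "'a::euclidean_space \<Rightarrow> 'a"
  assumes U: "open U" and f: "Ck_on 1 U f"
    and y: "\<And>t. t \<in> {0..1} \<Longrightarrow> y t \<in> U"
      "\<And>t. t \<in> {0..1} \<Longrightarrow> (y has_vector_derivative f (y t)) (at t within {0..1})"
    and z: "\<And>t. t \<in> {0..1} \<Longrightarrow> z t \<in> U"
      "\<And>t. t \<in> {0..1} \<Longrightarrow> (z has_vector_derivative f (z t)) (at t within {0..1})"
    and "y 0 = z 0" and s: "s \<in> {0..1}"
  shows "y s = z s"
proof -
  have cont: "continuous_on {0..1} y" "continuous_on {0..1} z"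
    unfolding continuous_on_eq_continuous_within
    using has_vector_derivative_continuous[OF y(2)] has_vector_derivative_continuous[OF z(2)] by blast+
  define K where "K = y ` {0..1} \<union> z ` {0..1}"
  have "compact K"
    unfolding K_def by (intro compact_Un compact_continuous_image cont compact_Icc)
  moreover have "K \<subseteq> U"
    using y(1) z(1) by (auto simp: K_def)
  ultimately have K: "compact K" "K \<subseteq> U" .
  have f': "(f has_derivative frechet_derivative f (at x)) (at x)" if "x \<in> U" for x
    using f that Ck_on_has_derivative[of 0 U f x] by simp
  have B: "blinfun_apply (Blinfun (frechet_derivative f (at x))) = frechet_derivative f (at x)" if "x \<in> U" for x
    by (rule bounded_linear_Blinfun_apply[OF has_derivative_bounded_linear[OF f'[OF that]]])
  \<comment> \<open>The union \<open>K\<close> of the trajectories need not be convex, so the mean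
    value inequality does not apply to it; local Lipschitz continuity on \<open>U\<close> and
    compactness of \<open>K\<close> replace it.\<close>
  have "local_lipschitz (UNIV::real set) U (\<lambda>_. f)"
  proof (rule c1_implies_local_lipschitz[where f' = "\<lambda>p. Blinfun (frechet_derivative f (at (snd p)))"])
    show "continuous_on ((UNIV::real set) \<times> U) (\<lambda>p. Blinfun (frechet_derivative f (at (snd p))))"
    proof (rule continuous_on_blinfun_componentwise)
      fix b :: 'a
      have c: "continuous_on U (\<lambda>x. frechet_derivative f (at x) b)"
        using f by simp
      have "continuous_on ((UNIV::real set) \<times> U) (\<lambda>p. frechet_derivative f (at (snd p)) b)"
        by (rule continuous_on_compose2[OF c]) (auto intro: continuous_intros)
      then show "continuous_on ((UNIV::real set) \<times> U) (\<lambda>p. Blinfun (frechet_derivative f (at (snd p))) b)"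
        by (rule continuous_on_eq) (auto simp: B)
    qed
  qed (use U f' B in auto)
  from local_lipschitz_subset[OF this subset_UNIV K(2), of "{0}"]
  obtain L where "\<And>t::real. t \<in> {0} \<Longrightarrow> L-lipschitz_on K f"
    by (rule local_lipschitz_compact_implies_lipschitz[OF _ K(1), of "{0}"]) simp_all
  then have L: "L-lipschitz_on K f" by simp
  \<comment> \<open>Gronwall: \<open>u\<close> is nonincreasing\<close>
  define u where "u t = exp (- (2 * L * t)) * (norm (y t - z t))\<^sup>2" for t
  have "u s \<le> u 0"
  proof (rule DERIV_nonpos_imp_decreasing_open[where f = u and a = 0 and b = s])
    show "0 \<le> s" using s by simp
    show "continuous_on {0..s} u"
      unfolding u_def using s by (auto intro!: continuous_intros continuous_on_subset[OF cont(1)] continuous_on_subset[OF cont(2)])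
    fix t assume t: "0 < t" "t < s"
    then have t': "t \<in> {0..1}" "t \<in> {0<..<1}" using s by auto
    have at: "at t within {0..1} = at t"
      by (rule at_within_interior) (use t' in simp)
    have D: "(y has_derivative (\<lambda>h. h *\<^sub>R f (y t))) (at t)" "(z has_derivative (\<lambda>h. h *\<^sub>R f (z t))) (at t)"
      using y(2)[OF t'(1)] z(2)[OF t'(1)] by (simp_all add: at has_vector_derivative_def)
    define m where "m = exp (- (2 * L * t)) * (2 * ((y t - z t) \<bullet> (f (y t) - f (z t))) - 2 * L * (norm (y t - z t))\<^sup>2)"
    have "(u has_real_derivative m) (at t)"
      unfolding u_def power2_norm_eq_inner has_field_derivative_def m_def
      by (rule derivative_eq_intros D refl)+
         (auto simp: fun_eq_iff algebra_simps inner_commute)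
    moreover have "m \<le> 0"
    proof -
      have "norm (f (y t) - f (z t)) \<le> L * norm (y t - z t)"
        using lipschitz_onD[OF L, of "y t" "z t"] t' by (auto simp: K_def dist_norm)
      then have "(y t - z t) \<bullet> (f (y t) - f (z t)) \<le> norm (y t - z t) * (L * norm (y t - z t))"
        by (intro order_trans[OF norm_cauchy_schwarz] mult_left_mono) auto
      then have "2 * ((y t - z t) \<bullet> (f (y t) - f (z t))) - 2 * L * (norm (y t - z t))\<^sup>2 \<le> 0"
        by (simp add: power2_eq_square mult_ac)
      then show ?thesis
        unfolding m_def by (intro mult_nonneg_nonpos) simp_all
    qed
    ultimately show "\<exists>m. (u has_real_derivative m) (at t) \<and> m \<le> 0" by blast
  qed
  then have "exp (- (2 * L * s)) * (norm (y s - z s))\<^sup>2 \<le> 0"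
    using assms(7) by (simp add: u_def)
  then show ?thesis by (simp add: mult_le_0_iff)
qed

section \<open>Geodesics and the exponential map\<close>

text \<open>The derivative is a multiple of the square of the function itself, so the induction
  closes without any other function.\<close>

lemma Ck_on_inverse: "Ck_on k (- {0}) (inverse :: real \<Rightarrow> real)"
proof (induction k)
  case (Suc k)
  have D: "frechet_derivative inverse (at x) h = - (h * (inverse x * inverse x))" if "x \<noteq> 0" for x h :: real
    by (subst frechet_derivative_at[OF has_derivative_inverse'[OF that], symmetric]) simp
  have "Ck_on k (- {0}) (\<lambda>x. frechet_derivative inverse (at x) h)" for h :: real
  proof (rule Ck_on_cong)
    show "Ck_on k (- {0}) (\<lambda>x. (- h) * (inverse x * inverse x))"
      by (intro Ck_on_bilinear[OF bounded_bilinear_mult] Ck_on_const Suc) auto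
  qed (auto simp: D)
  then show ?case
    using differentiableI[OF has_derivative_inverse'] by auto
qed (auto intro!: continuous_intros)

lemma Ck_on_mult:
  fixes f g :: "'a::euclidean_space \<Rightarrow> real"
  assumes "open V" "Ck_on k V f" "Ck_on k V g"
  shows "Ck_on k V (\<lambda>x. f x * g x)"
  by (rule Ck_on_bilinear[OF bounded_bilinear_mult assms])

lemma Ck_on_prod:
  fixes f :: "'i \<Rightarrow> 'a::euclidean_space \<Rightarrow> real"
  assumes "open V" "\<And>i. i \<in> I \<Longrightarrow> Ck_on k V (f i)"
  shows "Ck_on k V (\<lambda>x. \<Prod>i\<in>I. f i x)"
  using assms(2)
  by (induction I rule: infinite_finite_induct) (auto intro: Ck_on_const Ck_on_mult assms(1))

lemma Ck_on_divide:
  fixes f g :: "'a::euclidean_space \<Rightarrow> real"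
  assumes "open V" "Ck_on k V f" "Ck_on k V g" "\<And>x. x \<in> V \<Longrightarrow> g x \<noteq> 0"
  shows "Ck_on k V (\<lambda>x. f x / g x)"
  unfolding divide_inverse
  by (intro Ck_on_mult assms Ck_on_compose[OF assms(1) Ck_on_inverse]) (use assms(4) in auto)

lemma Ck_on_det:
  fixes A :: "'a::euclidean_space \<Rightarrow> real^'n^'n"
  assumes "open V" "\<And>i j. Ck_on k V (\<lambda>x. A x $ i $ j)"
  shows "Ck_on k V (\<lambda>x. det (A x))"
  unfolding det_def by (intro Ck_on_sum Ck_on_mult Ck_on_prod Ck_on_const assms)

text \<open>Cramer's rule for the equation solved by column \<open>l\<close> of the inverse. It
  turns the choice-based \<open>matrix_inv\<close> into a quotient of polynomials in the entries,
  whose smoothness is elementary.\<close>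

lemma matrix_inv_entry:
  fixes A :: "real^'n^'n"
  assumes "invertible A"
  shows "matrix_inv A $ k $ l = det (\<chi> i j. if j = k then axis l 1 $ i else A $ i $ j) / det A"
proof -
  have inv: "A ** matrix_inv A = mat 1"
    using assms unfolding invertible_def matrix_inv_def by (metis (mono_tags, lifting) someI_ex)
  have "A *v (matrix_inv A *v axis l 1) = axis l 1"
    by (simp add: matrix_vector_mul_assoc inv)
  then have "matrix_inv A *v axis l 1 = (\<chi> k. det (\<chi> i j. if j = k then axis l 1 $ i else A $ i $ j) / det A)"
    using cramer[of A] assms by (simp add: invertible_det_nz)
  then have "(matrix_inv A *v axis l 1) $ k = det (\<chi> i j. if j = k then axis l 1 $ i else A $ i $ j) / det A"
    by simp
  then show ?thesis
    by (simp add: matrix_vector_mul_component inner_axis)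
qed

lemma Ck_on_matrix_inv_entry:
  fixes A :: "'a::euclidean_space \<Rightarrow> real^'n^'n"
  assumes "open V" "\<And>i j. Ck_on k V (\<lambda>x. A x $ i $ j)" "\<And>x. x \<in> V \<Longrightarrow> invertible (A x)"
  shows "Ck_on k V (\<lambda>x. matrix_inv (A x) $ a $ b)"
proof (rule Ck_on_cong[OF assms(1)])
  show "Ck_on k V (\<lambda>x. det (\<chi> i j. if j = a then axis b 1 $ i else A x $ i $ j) / det (A x))"
  proof (intro Ck_on_divide Ck_on_det assms)
    fix i j
    show "Ck_on k V (\<lambda>x. (\<chi> i j. if j = a then axis b 1 $ i else A x $ i $ j) $ i $ j)"
      using assms(2)[of i j] Ck_on_const[OF assms(1)] by (cases "j = a") auto
  qed (use assms(3) invertible_det_nz in auto)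
qed (simp add: matrix_inv_entry assms(3))

lemma bounded_linear_matrix_entry: "bounded_linear (\<lambda>A::real^'n^'m. A $ i $ j)"
  by (intro bounded_linear_compose[OF bounded_linear_vec_nth] bounded_linear_vec_nth)

lemma Ck_on_christoffel:
  assumes "open M" "smooth_on M G" "\<And>x. x \<in> M \<Longrightarrow> invertible (G x)"
  shows "Ck_on n M (christoffel G k i j)"
proof -
  \<comment> \<open>Stated for every order: the Christoffel symbols contain first derivatives of
    \<open>G\<close>, so order \<open>n\<close> for them uses order \<open>Suc n\<close> of the
    entries.\<close>
  have entry: "Ck_on n M (\<lambda>x. G x $ a $ b)" for n a b
    by (rule Ck_on_compose[OF assms(1) Ck_on_linear[OF bounded_linear_matrix_entry open_UNIV]])
       (use assms(2) in \<open>auto simp: smooth_on_def\<close>)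
  have pd: "Ck_on n M (pderiv_at l (\<lambda>y. G y $ a $ b))" for l a b
    using entry[of "Suc n" a b] unfolding pderiv_at_def by simp
  have "Ck_on n M (\<lambda>x. (1/2) * (\<Sum>l\<in>UNIV. matrix_inv (G x) $ k $ l *
     (pderiv_at i (\<lambda>y. G y $ j $ l) x + (pderiv_at j (\<lambda>y. G y $ i $ l) x
      + (-1) * pderiv_at l (\<lambda>y. G y $ i $ j) x))))"
    by (intro Ck_on_mult Ck_on_sum Ck_on_add Ck_on_const Ck_on_matrix_inv_entry entry pd assms)
  then show ?thesis
    by (rule Ck_on_cong[OF assms(1)]) (simp add: christoffel_def algebra_simps)
qed

section \<open>The geodesic equation as a first-order system, and its homogeneity\<close>

text \<open>The geodesic spray in the chart: an autonomous vector field on pairs of position and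
  velocity.\<close>

definition geodesic_field ::
    "(real^'d::finite \<Rightarrow> real^'d^'d) \<Rightarrow> (real^'d) \<times> (real^'d) \<Rightarrow> (real^'d) \<times> (real^'d)" where
  "geodesic_field G p = (snd p,
     (\<chi> k. - (\<Sum>i\<in>UNIV. \<Sum>j\<in>UNIV. christoffel G k i j (fst p) * snd p $ i * snd p $ j)))"

text \<open>The acceleration is quadratic in the velocity. Both the rescaling of geodesics and the
  removal of the factor \<open>\<epsilon>\<close> from the flow rest on this.\<close>

lemma geodesic_field_scale:
  "geodesic_field G (x, s *\<^sub>R c) =
    (s *\<^sub>R fst (geodesic_field G (x, c)), s\<^sup>2 *\<^sub>R snd (geodesic_field G (x, c)))"
  by (simp add: geodesic_field_def vec_eq_iff sum_distrib_left power2_eq_square mult_ac)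

lemma smooth_on_geodesic_field:
  fixes G :: "real^'a::finite \<Rightarrow> real^'a^'a"
  assumes "open M" "smooth_on M G" "\<And>x. x \<in> M \<Longrightarrow> invertible (G x)"
  shows "smooth_on (M \<times> UNIV) (geodesic_field G)"
proof -
  let ?U = "M \<times> (UNIV :: (real^'a) set)"
  have U: "open ?U" by (intro open_Times assms open_UNIV)
  have nth: "Ck_on n ?U (\<lambda>p. snd p $ i)" for n i
    by (intro Ck_on_linear U bounded_linear_compose[OF bounded_linear_vec_nth] bounded_linear_snd)
  \<comment> \<open>The acceleration is expanded in the standard basis and negation becomes a factor
    -1, so that sums, products and linear maps suffice.\<close>
  have "Ck_on n ?U (\<lambda>p. (snd p, 0) + (\<Sum>k\<in>UNIV. ((-1) * (\<Sum>i\<in>UNIV. \<Sum>j\<in>UNIV.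
      christoffel G k i j (fst p) * snd p $ i * snd p $ j)) *\<^sub>R (0, axis k (1::real))))" for n
  proof (intro Ck_on_add Ck_on_sum Ck_on_bilinear[OF bounded_bilinear_scaleR] Ck_on_mult Ck_on_const U)
    show "Ck_on n ?U (\<lambda>p. (snd p, 0 :: real^'a))"
      by (intro Ck_on_linear U bounded_linear_Pair bounded_linear_snd bounded_linear_zero)
    show "Ck_on n ?U (\<lambda>p. christoffel G k i j (fst p))" for k i j
      by (rule Ck_on_compose[OF U Ck_on_christoffel[OF assms] Ck_on_linear[OF bounded_linear_fst U]]) auto
  qed (intro nth)+
  then have "Ck_on n ?U (geodesic_field G)" for n
  proof (rule Ck_on_cong[OF U])
    fix p
    show "(snd p, 0) + (\<Sum>k\<in>UNIV. ((-1) * (\<Sum>i\<in>UNIV. \<Sum>j\<in>UNIV.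
      christoffel G k i j (fst p) * snd p $ i * snd p $ j)) *\<^sub>R (0, axis k (1::real))) = geodesic_field G p"
      by (simp add: geodesic_field_def prod_eq_iff fst_sum snd_sum vec_eq_iff axis_def
          if_distrib[of "(*) _"] sum_negf cong: if_cong)
  qed
  then show ?thesis by (simp add: smooth_on_def)
qed

text \<open>Translates geodesics into solutions of the first-order system, to which local flow and
  uniqueness apply; the velocity field becomes the second component of \<open>\<xi>\<close>.\<close>

lemma geodesic_segment_iff:
  "geodesic_segment M G x v \<gamma> \<longleftrightarrow> (\<exists>\<xi>. \<gamma> = fst \<circ> \<xi> \<and> \<xi> 0 = (x, v) \<and>
     (\<forall>t\<in>{0..1}. \<xi> t \<in> M \<times> UNIV \<and>
       (\<xi> has_vector_derivative geodesic_field G (\<xi> t)) (at t within {0..1})))"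
proof
  assume "geodesic_segment M G x v \<gamma>"
  then obtain c where c: "\<gamma> ` {0..1} \<subseteq> M" "\<gamma> 0 = x" "c 0 = v" "\<And>t. t \<in> {0..1} \<Longrightarrow>
        (\<gamma> has_vector_derivative c t) (at t within {0..1}) \<and>
        (c has_vector_derivative
          (\<chi> k. - (\<Sum>i\<in>UNIV. \<Sum>j\<in>UNIV. christoffel G k i j (\<gamma> t) * c t $ i * c t $ j)))
          (at t within {0..1})"
    unfolding geodesic_segment_def by blast
  show "\<exists>\<xi>. \<gamma> = fst \<circ> \<xi> \<and> \<xi> 0 = (x, v) \<and> (\<forall>t\<in>{0..1}. \<xi> t \<in> M \<times> UNIV \<and>
       (\<xi> has_vector_derivative geodesic_field G (\<xi> t)) (at t within {0..1}))"
    by (rule exI[of _ "\<lambda>t. (\<gamma> t, c t)"])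
       (use c in \<open>auto simp: geodesic_field_def intro!: has_vector_derivative_Pair\<close>)
next
  assume "\<exists>\<xi>. \<gamma> = fst \<circ> \<xi> \<and> \<xi> 0 = (x, v) \<and> (\<forall>t\<in>{0..1}. \<xi> t \<in> M \<times> UNIV \<and>
       (\<xi> has_vector_derivative geodesic_field G (\<xi> t)) (at t within {0..1}))"
  then obtain \<xi> where \<xi>: "\<gamma> = fst \<circ> \<xi>" "\<xi> 0 = (x, v)" "\<And>t. t \<in> {0..1} \<Longrightarrow> \<xi> t \<in> M \<times> UNIV"
      "\<And>t. t \<in> {0..1} \<Longrightarrow> (\<xi> has_vector_derivative geodesic_field G (\<xi> t)) (at t within {0..1})"
    by blast
  have "(\<gamma> has_vector_derivative snd (\<xi> t)) (at t within {0..1})"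
       "((snd \<circ> \<xi>) has_vector_derivative
          (\<chi> k. - (\<Sum>i\<in>UNIV. \<Sum>j\<in>UNIV. christoffel G k i j (fst (\<xi> t)) * snd (\<xi> t) $ i * snd (\<xi> t) $ j)))
          (at t within {0..1})" if "t \<in> {0..1}" for t
    using bounded_linear.has_vector_derivative[OF bounded_linear_fst \<xi>(4)[OF that]]
      bounded_linear.has_vector_derivative[OF bounded_linear_snd \<xi>(4)[OF that]]
    by (simp_all add: geodesic_field_def \<xi>(1) o_def)
  moreover have "\<gamma> ` {0..1} \<subseteq> M" using \<xi>(1,3) by (auto simp: mem_Times_iff)
  ultimately show "geodesic_segment M G x v \<gamma>"
    unfolding geodesic_segment_def using \<xi>(1,2) by (auto intro!: exI[of _ "snd \<circ> \<xi>"])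
qed

text \<open>Running along \<open>\<gamma>\<close> at the fraction \<open>s\<close> of the speed
  multiplies the velocity by \<open>s\<close> and the acceleration by the square of
  \<open>s\<close>, in accordance with \<open>geodesic_field_scale\<close>. The case
  \<open>s = 0\<close> is included and yields the value of the exponential map at 0.\<close>

lemma geodesic_segment_scale:
  assumes "geodesic_segment M G x v \<gamma>" "s \<in> {0..1}"
  shows "geodesic_segment M G x (s *\<^sub>R v) (\<lambda>t. \<gamma> (s * t))"
proof -
  from assms(1) obtain \<xi> where \<xi>: "\<gamma> = fst \<circ> \<xi>" "\<xi> 0 = (x, v)" "\<And>t. t \<in> {0..1} \<Longrightarrow> \<xi> t \<in> M \<times> UNIV"
      "\<And>t. t \<in> {0..1} \<Longrightarrow> (\<xi> has_vector_derivative geodesic_field G (\<xi> t)) (at t within {0..1})"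
    unfolding geodesic_segment_iff by blast
  define \<zeta> where "\<zeta> t = (fst (\<xi> (s * t)), s *\<^sub>R snd (\<xi> (s * t)))" for t
  have st: "s * t \<in> {0..1}" if "t \<in> {0..1}" for t
    using that assms(2) by (auto simp: mult_le_one)
  have "(\<zeta> has_vector_derivative geodesic_field G (\<zeta> t)) (at t within {0..1})" if t: "t \<in> {0..1}" for t
  proof -
    have "((*) s has_vector_derivative s) (at t within {0..1})"
      by (auto intro!: derivative_eq_intros)
    \<comment> \<open>Derivatives are taken within the interval, one-sided at its ends; the chain
      rule asks for them within the image of the scaling, which is a subset.\<close>
    moreover have "(\<xi> has_vector_derivative geodesic_field G (\<xi> (s * t))) (at (s * t) within (*) s ` {0..1})"
      by (rule has_vector_derivative_within_subset[OF \<xi>(4)[OF st[OF t]]]) (use st in auto)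
    ultimately have D: "((\<lambda>t. \<xi> (s * t)) has_vector_derivative s *\<^sub>R geodesic_field G (\<xi> (s * t))) (at t within {0..1})"
      using vector_diff_chain_within[of "(*) s"] by (simp add: o_def)
    have "(\<zeta> has_vector_derivative (fst (s *\<^sub>R geodesic_field G (\<xi> (s * t))),
        s *\<^sub>R snd (s *\<^sub>R geodesic_field G (\<xi> (s * t))))) (at t within {0..1})"
      unfolding \<zeta>_def
      by (intro has_vector_derivative_Pair bounded_linear.has_vector_derivative[OF bounded_linear_fst D]
          bounded_linear.has_vector_derivative[OF bounded_linear_scaleR_right]
          bounded_linear.has_vector_derivative[OF bounded_linear_snd D])
    then show ?thesis
      unfolding \<zeta>_def geodesic_field_scale by (simp add: power2_eq_square)
  qed
  moreover have "(\<lambda>t. \<gamma> (s * t)) = fst \<circ> \<zeta>" "\<zeta> 0 = (x, s *\<^sub>R v)" "\<And>t. t \<in> {0..1} \<Longrightarrow> \<zeta> t \<in> M \<times> UNIV"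
    using \<xi> st by (auto simp: \<zeta>_def fun_eq_iff mem_Times_iff)
  ultimately show ?thesis
    unfolding geodesic_segment_iff by blast
qed

section \<open>The exponential map is well defined and a retraction\<close>

text \<open>Gives the description in \<open>riemannian_exp\<close> its meaning: two geodesic
  segments with the same initial data lift to solutions of the same system. No smallness of
  \<open>v\<close> is involved.\<close>

lemma riemannian_exp_eqI:
  assumes M: "open M" "smooth_on M G" "\<And>x. x \<in> M \<Longrightarrow> invertible (G x)"
    and \<gamma>: "geodesic_segment M G x v \<gamma>"
  shows "riemannian_exp M G x v = \<gamma> 1"
proof -
  have "\<gamma>' 1 = \<gamma> 1" if \<gamma>': "geodesic_segment M G x v \<gamma>'" for \<gamma>'
  proof -
    from \<gamma> obtain \<xi> where \<xi>: "\<gamma> = fst \<circ> \<xi>" "\<xi> 0 = (x, v)" "\<And>t. t \<in> {0..1} \<Longrightarrow> \<xi> t \<in> M \<times> UNIV"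
        "\<And>t. t \<in> {0..1} \<Longrightarrow> (\<xi> has_vector_derivative geodesic_field G (\<xi> t)) (at t within {0..1})"
      unfolding geodesic_segment_iff by blast
    from \<gamma>' obtain \<xi>' where \<xi>': "\<gamma>' = fst \<circ> \<xi>'" "\<xi>' 0 = (x, v)" "\<And>t. t \<in> {0..1} \<Longrightarrow> \<xi>' t \<in> M \<times> UNIV"
        "\<And>t. t \<in> {0..1} \<Longrightarrow> (\<xi>' has_vector_derivative geodesic_field G (\<xi>' t)) (at t within {0..1})"
      unfolding geodesic_segment_iff by blast
    have "Ck_on 1 (M \<times> UNIV) (geodesic_field G)"
      using smooth_on_geodesic_field[OF M] by (simp only: smooth_on_def)
    then have "\<xi>' 1 = \<xi> 1"
      by (rule ode_solution_unique[OF open_Times[OF M(1) open_UNIV]]) (use \<xi> \<xi>' in auto)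
    then show ?thesis by (simp add: \<xi>(1) \<xi>'(1))
  qed
  then show ?thesis
    unfolding riemannian_exp_def using \<gamma> by (intro the_equality) blast+
qed

lemma riemannian_exp_retraction:
  fixes G :: "real^'a::finite \<Rightarrow> real^'a^'a"
  assumes M: "open M" "smooth_on M G" "\<And>x. x \<in> M \<Longrightarrow> invertible (G x)" and x: "x \<in> M"
  shows "0 \<in> interior (exp_domain M G x)" "retraction_at M x (riemannian_exp M G x)"
proof -
  let ?E = "riemannian_exp M G x"
  obtain \<epsilon> r X where \<epsilon>: "\<epsilon> > 0" "r > 0"
    and X: "\<And>p. p \<in> ball (x, 0) r \<Longrightarrow> X (0, p) = p"
    "\<And>t p. t \<in> {0..1} \<Longrightarrow> p \<in> ball (x, 0) r \<Longrightarrow> X (t, p) \<in> M \<times> UNIV"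
    "\<And>t p. t \<in> {0..1} \<Longrightarrow> p \<in> ball (x, 0) r \<Longrightarrow>
      ((\<lambda>t. X (t, p)) has_vector_derivative \<epsilon> *\<^sub>R geodesic_field G (X (t, p))) (at t within {0..1})"
    "\<And>k. Ck_on k (ball (x, 0) r) (\<lambda>p. X (1, p))"
    by (rule local_flow[OF open_Times[OF M(1) open_UNIV] _ smooth_on_geodesic_field[OF M], of "(x, 0)"])
       (use x in auto)
  define N where "N = ball (0 :: real^'a) (\<epsilon> * r)"
  \<comment> \<open>With initial velocity \<open>v /\<^sub>R \<epsilon>\<close>, the field scaled by
    \<open>\<epsilon>\<close> moves the position initially with velocity \<open>v\<close>; the
    radius \<open>\<epsilon> * r\<close> of \<open>N\<close> keeps \<open>P v\<close> in the domain
    of the flow.\<close>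
  define P where "P v = (x, v /\<^sub>R \<epsilon>)" for v :: "real^'a"
  have N: "open N" "0 \<in> N" using \<epsilon> by (auto simp: N_def)
  have P: "P v \<in> ball (x, 0) r" if "v \<in> N" for v
    using that \<epsilon> by (simp add: N_def P_def dist_Pair_Pair dist_norm field_simps)
  have geo: "geodesic_segment M G x v (\<lambda>t. fst (X (t, P v)))" if v: "v \<in> N" for v
  proof -
    \<comment> \<open>Scaling the velocity component back by \<open>\<epsilon>\<close> turns a
      solution of the scaled field into one of the geodesic field itself.\<close>
    define \<xi> where "\<xi> t = (fst (X (t, P v)), \<epsilon> *\<^sub>R snd (X (t, P v)))" for t
    have "(\<xi> has_vector_derivative geodesic_field G (\<xi> t)) (at t within {0..1})" if t: "t \<in> {0..1}" for t
    proof -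
      note D = X(3)[OF t P[OF v]]
      have "(\<xi> has_vector_derivative (fst (\<epsilon> *\<^sub>R geodesic_field G (X (t, P v))),
          \<epsilon> *\<^sub>R snd (\<epsilon> *\<^sub>R geodesic_field G (X (t, P v))))) (at t within {0..1})"
        unfolding \<xi>_def
        by (intro has_vector_derivative_Pair bounded_linear.has_vector_derivative[OF bounded_linear_fst D]
            bounded_linear.has_vector_derivative[OF bounded_linear_scaleR_right]
            bounded_linear.has_vector_derivative[OF bounded_linear_snd D])
      then show ?thesis
        unfolding \<xi>_def geodesic_field_scale by (simp add: power2_eq_square)
    qed
    moreover have "\<xi> 0 = (x, v)"
      using X(1)[OF P[OF v]] \<epsilon> by (simp add: \<xi>_def P_def)
    moreover have "\<xi> t \<in> M \<times> UNIV" if "t \<in> {0..1}" for t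
      using X(2)[OF that P[OF v]] by (auto simp: \<xi>_def mem_Times_iff)
    moreover have "(\<lambda>t. fst (X (t, P v))) = fst \<circ> \<xi>"
      by (auto simp: \<xi>_def)
    ultimately show ?thesis
      unfolding geodesic_segment_iff by blast
  qed
  have E: "?E v = fst (X (1, P v))" if "v \<in> N" for v
    by (rule riemannian_exp_eqI[OF M geo[OF that]])
  have "N \<subseteq> exp_domain M G x"
    using geo by (auto simp: exp_domain_def)
  then show "0 \<in> interior (exp_domain M G x)"
    using N interiorI by blast
  have Ck: "Ck_on k N ?E" for k
  proof (rule Ck_on_cong[OF N(1)])
    have "Ck_on k N (\<lambda>v. (x, 0) + (0, v /\<^sub>R \<epsilon>))"
      by (intro Ck_on_add Ck_on_const N Ck_on_linear bounded_linear_Pair bounded_linear_zero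
          bounded_linear_scaleR_right)
    then have "Ck_on k N P"
      by (rule Ck_on_cong[OF N(1)]) (simp add: P_def)
    then have "Ck_on k N (\<lambda>v. X (1, P v))"
      by (rule Ck_on_compose[OF N(1) X(4)]) (use P in auto)
    then show "Ck_on k N (\<lambda>v. fst (X (1, P v)))"
      by (rule Ck_on_compose[OF N(1) Ck_on_linear[OF bounded_linear_fst open_UNIV]]) auto
  qed (simp add: E)
  have EM: "?E ` N \<subseteq> M"
    using E X(2)[OF _ P, of 1] by (auto simp: mem_Times_iff)
  have E_ray: "?E (s *\<^sub>R v) = fst (X (s, P v))" if "v \<in> N" "s \<in> {0..1}" for s v
    using riemannian_exp_eqI[OF M geodesic_segment_scale[OF geo[OF that(1)] that(2)]] by simp
  have E0: "?E 0 = x"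
    using E_ray[OF N(2), of 0] X(1)[OF P[OF N(2)]] by (simp add: P_def)
  define D where "D = frechet_derivative ?E (at 0)"
  have D: "(?E has_derivative D) (at 0)"
    unfolding D_def by (rule Ck_on_has_derivative[OF Ck N(2)])
  have DN: "D v = v" if v: "v \<in> N" for v
  proof -
    \<comment> \<open>One-sided at 0, because the geodesic describes the ray for \<open>s\<close> in
      \<open>{0..1}\<close> only; the one-sided derivative still determines
      \<open>D v\<close>.\<close>
    have "(?E \<circ> (\<lambda>s. s *\<^sub>R v) has_derivative D \<circ> (\<lambda>s. s *\<^sub>R v)) (at 0 within {0..1})"
      by (rule diff_chain_within) (auto intro!: derivative_eq_intros has_derivative_at_withinI[OF D])
    then have "((\<lambda>s. ?E (s *\<^sub>R v)) has_vector_derivative D v) (at 0 within {0..1})"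
      using linear_scale[OF has_derivative_linear[OF D]] by (simp add: has_vector_derivative_def o_def)
    then have 1: "((\<lambda>s. fst (X (s, P v))) has_vector_derivative D v) (at 0 within {0..1})"
      by (rule has_vector_derivative_transform[rotated 2]) (simp_all add: E_ray[OF v])
    have "((\<lambda>s. fst (X (s, P v))) has_vector_derivative fst (\<epsilon> *\<^sub>R geodesic_field G (X (0, P v)))) (at 0 within {0..1})"
      by (rule bounded_linear.has_vector_derivative[OF bounded_linear_fst X(3)[OF _ P[OF v]]]) simp
    also have "fst (\<epsilon> *\<^sub>R geodesic_field G (X (0, P v))) = v"
      using X(1)[OF P[OF v]] \<epsilon> by (simp add: geodesic_field_def P_def)
    finally show ?thesis
      using vector_derivative_unique_within_closed_interval[of 0 1 0 _ "D v" v] 1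
      by (simp add: cbox_interval)
  qed
  have "D v = v" for v
  proof (cases "v = 0")
    case False
    \<comment> \<open>Places \<open>s *\<^sub>R v\<close> at half the radius of \<open>N\<close>;
      linearity of \<open>D\<close> carries the identity from there to \<open>v\<close>.\<close>
    define s where "s = \<epsilon> * r / (2 * norm v)"
    have s: "s > 0" using False \<epsilon> by (simp add: s_def)
    have "s *\<^sub>R v \<in> N" using False \<epsilon> by (simp add: N_def s_def)
    then have "s *\<^sub>R D v = s *\<^sub>R v"
      using DN linear_scale[OF has_derivative_linear[OF D]] by metis
    then show ?thesis using s by simp
  qed (use DN N in auto)
  then have "(?E has_derivative (\<lambda>v. v)) (at 0)"
    using has_derivative_eq_rhs[OF D, of "\<lambda>v. v"] by blast
  then show "retraction_at M x ?E"
    unfolding retraction_at_def smooth_on_def using N Ck EM E0 by blast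
qed

section \<open>Quadratic remainder bounds along rays\<close>

text \<open>Being differentiable at 0 with value 0 there, \<open>f'\<close> has a bound linear in
  \<open>t\<close>, which the mean value inequality turns into a quadratic one for
  \<open>f\<close>.\<close>

lemma bigo_square_if_derivative_vanishes:
  fixes f :: "real \<Rightarrow> 'a::real_normed_vector"
  assumes "r > 0" and f: "\<And>t. \<bar>t\<bar> < r \<Longrightarrow> (f has_vector_derivative f' t) (at t)"
    and "f 0 = 0" "f' 0 = 0" "f' differentiable (at 0)"
  shows "(\<lambda>t. norm (f t)) \<in> O[at 0](\<lambda>t. t\<^sup>2)"
proof -
  from assms(5) obtain B where B: "(f' has_derivative B) (at 0)"
    by (auto simp: differentiable_def)
  obtain b where b: "\<And>h. norm (B h) \<le> norm h * b"
    using bounded_linear.bounded[OF has_derivative_bounded_linear[OF B]] by blast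
  \<comment> \<open>The definition of the derivative of \<open>f'\<close> at 0, with tolerance
    1.\<close>
  obtain d where d: "d > 0" "\<And>t. \<bar>t\<bar> < d \<Longrightarrow> norm (f' t - B t) \<le> \<bar>t\<bar>"
    using B[unfolded has_derivative_at_alt, THEN conjunct2, rule_format, of 1] assms(4) by auto
  have f'_le: "norm (f' t) \<le> (b + 1) * \<bar>t\<bar>" if "\<bar>t\<bar> < d" for t
    using norm_triangle_sub[of "f' t" "B t"] b[of t] d(2)[OF that] by (simp add: algebra_simps)
  have "norm (f t) \<le> \<bar>b + 1\<bar> * t\<^sup>2" if t: "\<bar>t\<bar> < min d r" for t
  proof -
    have "norm (f t - f 0) \<le> (\<bar>b + 1\<bar> * \<bar>t\<bar>) * norm (t - 0)"
    \<comment> \<open>The symmetric interval treats both signs of \<open>t\<close> at once.\<close>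
    proof (rule differentiable_bound[of "cball 0 \<bar>t\<bar>" f "\<lambda>s h. h *\<^sub>R f' s"])
      fix s :: real assume s: "s \<in> cball 0 \<bar>t\<bar>"
      show "(f has_derivative (\<lambda>h. h *\<^sub>R f' s)) (at s within cball 0 \<bar>t\<bar>)"
        using f[of s] s t by (auto simp: has_vector_derivative_def intro: has_derivative_at_withinI)
      have "norm (f' s) \<le> \<bar>b + 1\<bar> * \<bar>t\<bar>"
        using s t by (intro order_trans[OF f'_le] mult_mono) auto
      then show "onorm (\<lambda>h. h *\<^sub>R f' s) \<le> \<bar>b + 1\<bar> * \<bar>t\<bar>"
        by (intro onorm_le) (simp add: mult.commute mult_left_mono)
    qed auto
    then show ?thesis using assms(3) by (simp add: power2_eq_square mult.assoc)
  qed
  then have "\<forall>\<^sub>F t in at 0. norm (norm (f t)) \<le> \<bar>b + 1\<bar> * norm (t\<^sup>2)"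
    using d(1) assms(1) by (auto simp: eventually_at intro!: exI[of _ "min d r"])
  then show ?thesis by (rule bigoI)
qed

lemma retraction_at_first_order:
  assumes "retraction_at M x R"
  shows "(\<lambda>\<eta>. norm (R (- (\<eta> *\<^sub>R w)) - (x - \<eta> *\<^sub>R w))) \<in> O[at 0](\<lambda>\<eta>. \<eta>\<^sup>2)"
proof -
  obtain N where N: "open N" "0 \<in> N" and R: "\<And>k. Ck_on k N R" "R 0 = x" "(R has_derivative (\<lambda>v. v)) (at 0)"
    using assms unfolding retraction_at_def smooth_on_def by blast
  obtain \<rho> where \<rho>: "\<rho> > 0" "ball 0 \<rho> \<subseteq> N" using N open_contains_ball by blast
  \<comment> \<open>Keeps the ray inside the ball of radius \<open>\<rho>\<close>; the
    \<open>+ 1\<close> covers \<open>w = 0\<close>.\<close>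
  define r where "r = \<rho> / (norm w + 1)"
  have r: "r > 0" using \<rho> by (auto simp: r_def intro!: divide_pos_pos add_nonneg_pos)
  define f' where "f' \<eta> = w - frechet_derivative R (at (- (\<eta> *\<^sub>R w))) w" for \<eta>
  have inN: "- (\<eta> *\<^sub>R w) \<in> N" if "\<bar>\<eta>\<bar> < r" for \<eta>
  proof -
    have "\<bar>\<eta>\<bar> * norm w \<le> \<bar>\<eta>\<bar> * (norm w + 1)" by (simp add: mult_left_mono)
    also have "\<dots> < \<rho>"
      using that by (simp add: r_def pos_less_divide_eq add_nonneg_pos)
    finally show ?thesis using \<rho> by auto
  qed
  show ?thesis
  proof (rule bigo_square_if_derivative_vanishes[OF r, where f' = f'])
    fix \<eta> :: real assume "\<bar>\<eta>\<bar> < r"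
    note D = Ck_on_has_derivative[OF R(1) inN[OF this]]
    have "(R \<circ> (\<lambda>\<eta>. - (\<eta> *\<^sub>R w)) has_derivative
        frechet_derivative R (at (- (\<eta> *\<^sub>R w))) \<circ> (\<lambda>h. - (h *\<^sub>R w))) (at \<eta>)"
      by (rule diff_chain_at, (auto intro!: derivative_eq_intros)[1], rule D)
    then have "((\<lambda>\<eta>. R (- (\<eta> *\<^sub>R w))) has_vector_derivative - frechet_derivative R (at (- (\<eta> *\<^sub>R w))) w) (at \<eta>)"
      using linear_scale[OF has_derivative_linear[OF D]] linear_neg[OF has_derivative_linear[OF D]]
      by (simp add: has_vector_derivative_def o_def)
    then show "((\<lambda>\<eta>. R (- (\<eta> *\<^sub>R w)) - (x - \<eta> *\<^sub>R w)) has_vector_derivative f' \<eta>) (at \<eta>)"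
      unfolding f'_def by (auto intro!: derivative_eq_intros)
  next
    show "f' 0 = 0"
      using frechet_derivative_at[OF R(3)] by (simp add: f'_def flip: frechet_derivative_at[OF R(3)])
    have "(\<lambda>v. frechet_derivative R (at v) w) differentiable (at (- (0 *\<^sub>R w)))"
      using R(1)[of "Suc (Suc 0)"] N by simp
    then have "((\<lambda>v. frechet_derivative R (at v) w) \<circ> (\<lambda>\<eta>. - (\<eta> *\<^sub>R w))) differentiable (at (0::real))"
      by (intro differentiable_chain_at) auto
    then show "f' differentiable (at 0)"
      unfolding f'_def by (auto simp: o_def intro!: derivative_intros)
  qed (use R in auto)
qed

section \<open>The Riemannian gradient and the natural-gradient step\<close>

lemma frechet_derivative_eq_inner_grad:
  assumes "J differentiable (at x)"
  shows "frechet_derivative J (at x) v = euclidean_grad J x \<bullet> v"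
proof -
  have lin: "linear (frechet_derivative J (at x))"
    using assms by (rule linear_frechet_derivative)
  have "frechet_derivative J (at x) (\<Sum>i\<in>UNIV. (v $ i) *\<^sub>R axis i 1) = euclidean_grad J x \<bullet> v"
    by (simp add: linear_sum[OF lin] linear_scale[OF lin] euclidean_grad_def pderiv_at_def inner_vec_def mult.commute)
  then show ?thesis
    by (simp add: basis_expansion flip: scalar_mult_eq_scaleR)
qed

lemma invertible_if_pos_def:
  assumes "\<And>v. v \<noteq> 0 \<Longrightarrow> metric_of G x v v > 0"
  shows "invertible (G x)"
proof -
  have "v = 0" if "G x *v v = 0" for v
    using assms[of v] that by (auto simp: metric_of_def)
  then show ?thesis
    unfolding invertible_left_inverse matrix_left_invertible_ker by blast
qed

text \<open>Symmetry moves \<open>G x\<close> onto \<open>u\<close>, and testing against all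
  \<open>v\<close> leaves a linear system. As an equivalence it yields existence, uniqueness and the
  value of \<open>riemannian_grad\<close> together.\<close>

lemma riemannian_grad_eq:
  assumes sym: "transpose (G x) = G x" and inv: "invertible (G x)" and J: "J differentiable (at x)"
  shows "(\<forall>v. metric_of G x u v = frechet_derivative J (at x) v) \<longleftrightarrow>
    u = matrix_inv (G x) *v euclidean_grad J x"
proof -
  have id: "G x ** matrix_inv (G x) = mat 1 \<and> matrix_inv (G x) ** G x = mat 1"
    using inv unfolding invertible_def matrix_inv_def by (metis (mono_tags, lifting) someI_ex)
  have "metric_of G x u v = (G x *v u) \<bullet> v" for v
    unfolding metric_of_def using dot_lmul_matrix[of u "G x" v]
    by (metis sym vector_transpose_matrix)
  then have "(\<forall>v. metric_of G x u v = frechet_derivative J (at x) v) \<longleftrightarrow> G x *v u = euclidean_grad J x"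
    unfolding frechet_derivative_eq_inner_grad[OF J] by (simp add: vector_eq_rdot)
  also have "\<dots> \<longleftrightarrow> u = matrix_inv (G x) *v euclidean_grad J x"
    using id by (metis matrix_vector_mul_assoc matrix_vector_mul_lid)
  finally show ?thesis .
qed

text \<open>\<open>Exp\<close> and \<open>riemannian_grad\<close> are description terms: the
  interior point of \<open>exp_domain\<close> and the unique existence of the gradient vector ensure
  that they denote the intended objects, \<open>Exp\<close> for all small \<open>\<eta>\<close>. The
  bounds are two-sided in \<open>\<eta>\<close>.\<close>

theorem corollary1:
  fixes \<Theta> :: "(real^'d::finite) set"
    and P :: "'x measure" and \<nu> :: "'z measure"
    and q :: "real^'d \<Rightarrow> 'x \<Rightarrow> 'z \<Rightarrow> real"
    and J :: "real^'d \<Rightarrow> real"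
    and \<phi> :: "real^'d"
    and R :: "real^'d \<Rightarrow> real^'d"
  assumes "regular_statistical_manifold \<Theta> P \<nu> q"
    and "smooth_on \<Theta> J"
    and "\<phi> \<in> \<Theta>"
    and "retraction_at \<Theta> \<phi> R"
  defines "F \<equiv> fisher P \<nu> q"
  defines "Exp \<equiv> riemannian_exp \<Theta> F \<phi>"
  defines "w \<equiv> matrix_inv (F \<phi>) *v euclidean_grad J \<phi>"
  shows "0 \<in> interior (exp_domain \<Theta> F \<phi>) \<and>
     retraction_at \<Theta> \<phi> Exp \<and>
     (\<lambda>\<eta>. norm (Exp (- (\<eta> *\<^sub>R w)) - (\<phi> - \<eta> *\<^sub>R w))) \<in> O[at 0](\<lambda>\<eta>. \<eta>\<^sup>2) \<and>
     (\<lambda>\<eta>. norm (R (- (\<eta> *\<^sub>R w)) - (\<phi> - \<eta> *\<^sub>R w))) \<in> O[at 0](\<lambda>\<eta>. \<eta>\<^sup>2) \<and>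
     (\<exists>!u. \<forall>v. metric_of F \<phi> u v = frechet_derivative J (at \<phi>) v) \<and>
     riemannian_grad F J \<phi> = w \<and>
     (\<lambda>\<eta>. norm ((\<phi> - \<eta> *\<^sub>R w) - Exp (- (\<eta> *\<^sub>R riemannian_grad F J \<phi>)))) \<in> O[at 0](\<lambda>\<eta>. \<eta>\<^sup>2)"
proof -
  have M: "open \<Theta>" "smooth_on \<Theta> F" and inv: "\<And>x. x \<in> \<Theta> \<Longrightarrow> invertible (F x)"
    using assms(1) unfolding regular_statistical_manifold_def F_def
    by (auto intro: invertible_if_pos_def)
  have "Ck_on (Suc 0) \<Theta> J" using assms(2) unfolding smooth_on_def by blast
  then have "J differentiable (at \<phi>)" using assms(3) by simp
  then have grad: "(\<forall>v. metric_of F \<phi> u v = frechet_derivative J (at \<phi>) v) \<longleftrightarrow> u = w" for u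
    unfolding w_def by (intro riemannian_grad_eq inv assms(3)) (simp_all add: F_def transpose_fisher)
  then have rg: "riemannian_grad F J \<phi> = w"
    by (simp add: riemannian_grad_def)
  note Exp = riemannian_exp_retraction[OF M inv assms(3), folded Exp_def]
  note O_Exp = retraction_at_first_order[OF Exp(2), of w]
  show ?thesis
    using Exp O_Exp retraction_at_first_order[OF assms(4), of w] grad
    by (simp add: rg norm_minus_commute)
qed

end
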